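(* Let $f\in(\mathbb{R}/\mathbb{Z})\setminus\{0\}$. For every minimal valid non-extreme continuous piecewise linear function $\pi$ for $R_f(\mathbb{R}/\mathbb{Z})$ with rational breakpoints and rational values at the breakpoints, there exists a sequence $\{\phi_i\}_{i\in\mathbb{N}}$ of continuous piecewise linear extreme functions for $R_f(\mathbb{R}/\mathbb{Z})$ with rational breakpoints that converges uniformly to $\pi$ and such that for each $x\in\mathbb{Q}/\mathbb{Z}$, the sequence $\{\phi_i(x)\}_{i\in\mathbb{N}}$ is eventually constant.
   Context: For $f\in(\mathbb{R}/\mathbb{Z})\setminus\{0\}$, $R_f(\mathbb{R}/\mathbb{Z})$ is the convex hull of all finite-support functions $y\colon\mathbb{R}/\mathbb{Z}\to\mathbb{Z}_+$ with $\sum_p y(p)\,p=f$ in $\mathbb{R}/\mathbb{Z}$. A function $\pi\colon\mathbb{R}/\mathbb{Z}\to\mathbb{R}_+$ is valid for $R_f(\mathbb{R}/\mathbb{Z})$ if $\sum_p\pi(p)y(p)\ge1$ for all such $y$. A valid function $\pi$ is minimal if there is no valid $\pi^\dagger\neq\pi$ with $\pi^\dagger\le\pi$ pointwise. Equivalently (Gomory–Johnson), $\pi$ is minimal iff $\pi\ge0$, $\pi(0)=0$, $\pi(f)=1$, $\pi(x)+\pi(y)-\pi(x+y)\ge0$ for all $x,y$ (subadditivity), and $\pi(x)+\pi(f-x)=1$ for all $x$ (symmetry). A minimal valid function $\pi$ is extreme if, whenever $\pi=\frac12(\pi^++\pi^-)$ with $\pi^\pm$ minimal valid, then $\pi=\pi^+=\pi^-$.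 Functions on $\mathbb{R}/\mathbb{Z}$ are identified with $\mathbb{Z}$-periodic functions on $\mathbb{R}$; piecewise linear means affine on each of finitely many intervals (per period) whose endpoints are the breakpoints. *)

theory Defs
  imports "HOL-Analysis.Analysis"
begin

quotient_type circle = real / "\<lambda>x y :: real. x - y \<in> \<int>"
  morphisms rep_circle circle_of
proof (rule equivpI)
  show "reflp (\<lambda>x y :: real. x - y \<in> \<int>)"
    by (simp add: reflp_def)
  show "symp (\<lambda>x y :: real. x - y \<in> \<int>)"
    by (metis (no_types, lifting) Ints_minus minus_diff_eq sympI)
  show "transp (\<lambda>x y :: real. x - y \<in> \<int>)"
  proof (rule transpI)
    fix x y z :: real
    assume "x - y \<in> \<int>" "y - z \<in> \<int>"
    then have "(x - y) + (y - z) \<in> \<int>" by (rule Ints_add)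
    then show "x - z \<in> \<int>" by simp
  qed
qed

instantiation circle :: ab_group_add
begin

lift_definition zero_circle :: circle is "0 :: real" .

lift_definition plus_circle :: "circle \<Rightarrow> circle \<Rightarrow> circle" is "(+)"
proof -
  fix a b c d :: real
  assume "a - b \<in> \<int>" "c - d \<in> \<int>"
  then have "(a - b) + (c - d) \<in> \<int>" by (rule Ints_add)
  then show "(a + c) - (b + d) \<in> \<int>" by (simp add: algebra_simps)
qed

lift_definition uminus_circle :: "circle \<Rightarrow> circle" is "uminus"
  by (metis Ints_minus minus_diff_minus)

lift_definition minus_circle :: "circle \<Rightarrow> circle \<Rightarrow> circle" is "(-)"
proof -
  fix a b c d :: real
  assume "a - b \<in> \<int>" "c - d \<in> \<int>"
  then have "(a - b) - (c - d) \<in> \<int>" by (rule Ints_diff)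
  then show "(a - c) - (b - d) \<in> \<int>" by (simp add: algebra_simps)
qed

instance
  by standard (transfer; simp add: algebra_simps)+

end

text \<open>The quotient topology.\<close>

instantiation circle :: topological_space
begin

definition open_circle :: "circle set \<Rightarrow> bool" where
  "open_circle U \<longleftrightarrow> open (circle_of -` U)"

instance
  by standard (auto simp: open_circle_def vimage_Union)

end

lemma circle_of_eq_iff: "circle_of x = circle_of y \<longleftrightarrow> x - y \<in> \<int>"
  by transfer simp

lemma circle_of_0: "circle_of 0 = 0"
  by transfer simp

lemma circle_of_add: "circle_of (x + y) = circle_of x + circle_of y"
  by transfer simp

lemma continuous_on_circle_iff:
  fixes g :: "circle \<Rightarrow> 'a :: topological_space"
  shows "continuous_on UNIV g \<longleftrightarrow> continuous_on UNIV (\<lambda>x. g (circle_of x))"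
  by (simp add: continuous_on_open_vimage open_circle_def vimage_def)

definition nat_mult :: "nat \<Rightarrow> circle \<Rightarrow> circle" where
  "nat_mult n p = (\<Sum>i<n. p)"

text \<open>The finite-support functions whose convex hull is \<open>R\<^sub>f(\<real>/\<int>)\<close>. The hull itself is
  not needed: a linear inequality holds on the hull iff it holds on these functions.\<close>

definition feasible :: "circle \<Rightarrow> (circle \<Rightarrow> nat) set" where
  "feasible f = {y. finite {p. y p \<noteq> 0} \<and> (\<Sum>p | y p \<noteq> 0. nat_mult (y p) p) = f}"

definition valid :: "circle \<Rightarrow> (circle \<Rightarrow> real) \<Rightarrow> bool" where
  "valid f \<pi> \<longleftrightarrow>
     (\<forall>x. \<pi> x \<ge> 0) \<and> (\<forall>y\<in>feasible f. (\<Sum>p | y p \<noteq> 0. \<pi> p * real (y p)) \<ge> 1)"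

definition minimal_valid :: "circle \<Rightarrow> (circle \<Rightarrow> real) \<Rightarrow> bool" where
  "minimal_valid f \<pi> \<longleftrightarrow>
     valid f \<pi> \<and> \<not> (\<exists>\<pi>'. valid f \<pi>' \<and> \<pi>' \<noteq> \<pi> \<and> (\<forall>x. \<pi>' x \<le> \<pi> x))"

definition extreme :: "circle \<Rightarrow> (circle \<Rightarrow> real) \<Rightarrow> bool" where
  "extreme f \<pi> \<longleftrightarrow>
     minimal_valid f \<pi> \<and>
     (\<forall>\<pi>1 \<pi>2. minimal_valid f \<pi>1 \<longrightarrow> minimal_valid f \<pi>2 \<longrightarrow>
        (\<forall>x. \<pi> x = (\<pi>1 x + \<pi>2 x) / 2) \<longrightarrow> \<pi> = \<pi>1 \<and> \<pi> = \<pi>2)"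

text \<open>\<open>B\<close> is a set of breakpoints of the function, viewed as a periodic function on the reals:
  the intervals are those between consecutive points of the preimage of \<open>B\<close>. The intervals are
  open, so continuity is a separate condition. Without \<open>B \<noteq> {}\<close> there would be no
  intervals and the condition would be vacuous. \<open>B\<close> may contain points at which the slope
  does not change.\<close>

definition piecewise_linear_on :: "circle set \<Rightarrow> (circle \<Rightarrow> real) \<Rightarrow> bool" where
  "piecewise_linear_on B \<pi> \<longleftrightarrow>
     finite B \<and> B \<noteq> {} \<and>
     (\<forall>a b. a < b \<and> circle_of a \<in> B \<and> circle_of b \<in> B \<and> (\<forall>x\<in>{a<..<b}. circle_of x \<notin> B) \<longrightarrow>
        (\<exists>m c. \<forall>x\<in>{a<..<b}. \<pi> (circle_of x) = m * x + c))"

definition rational_points :: "circle set" where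
  "rational_points = circle_of ` \<rat>"

end

theory Submission
  imports Defs "HOL-Library.Multiset"
begin

text \<open>Lift \<open>\<pi>\<close> to a periodic function \<open>p\<close> on the reals, and let \<open>s\<close> and \<open>- m\<close> be its slopes to the
  right and to the left of \<open>0\<close>; by subadditivity all slopes of \<open>p\<close> lie between them, so
  \<open>p y \<le> p x + g (y - x)\<close> for the sublinear function \<open>g t = max (s t) (- m t)\<close>. The fill-in
  \<open>F x = min\<^sub>u (p (u / N) + g (x - u / N))\<close> from a fine grid has only the slopes \<open>s\<close> and \<open>- m\<close>, is
  subadditive, agrees with \<open>p\<close> on the grid and lies above \<open>p\<close>, but it is not symmetric. To
  symmetrize it, use \<open>F\<close> on the grid cells where \<open>p < 1/2\<close> (low cells) and its reflection
  \<open>1 - F (r - x)\<close> on those where \<open>p > 1/2\<close> (high cells), \<open>r\<close> being a lift of \<open>f\<close>.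

  Subadditivity of the result \<open>\<phi>\<close> says \<open>\<phi> x + \<phi> y + \<phi> z \<ge> 1\<close> whenever \<open>x + y + z = r\<close>. If at most
  one of the three points is high, this follows from the subadditivity of \<open>F\<close> and \<open>F \<ge> p\<close>. If one
  of them is near a zero of \<open>p\<close>, then \<open>\<phi>\<close> coincides with a translate of \<open>g\<close> there and the bound on
  the slopes of \<open>\<phi>\<close> suffices. Otherwise two of the points are high and \<open>p\<close> is bounded away from
  \<open>0\<close> at the third, so \<open>p\<close> itself has a slack that absorbs the error of the approximation.
  Extremality of \<open>\<phi>\<close> is an instance of the Gomory--Johnson two-slope theorem. For the sequence, take
  \<open>N\<close> to be a fixed multiple of \<open>n!\<close>, so that every rational point is eventually on the grid.\<close>

section \<open>Minimal valid functions\<close>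

text \<open>Finitely supported functions to the naturals are multisets. With \<open>h = id\<close>
  and \<open>h = \<pi>\<close> this turns feasibility and weight into multiset sums, which allow
  induction.\<close>

lemma sum_mset_image_conv_sum:
  fixes h :: "'a \<Rightarrow> 'b::comm_monoid_add"
  assumes "finite S" "set_mset A \<subseteq> S"
  shows "sum_mset (image_mset h A) = (\<Sum>p\<in>S. \<Sum>i<count A p. h p)"
  using assms(2)
proof (induction A)
  case empty
  then show ?case by simp
next
  case (add x A)
  have "(\<Sum>p\<in>S. \<Sum>i<count (add_mset x A) p. h p)
      = (\<Sum>p\<in>S. (if p = x then h x else 0) + (\<Sum>i<count A p. h p))"
    by (intro sum.cong) (auto simp: add.commute)
  also have "\<dots> = h x + sum_mset (image_mset h A)"
    using assms(1) add by (simp add: sum.distrib)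
  finally show ?case by simp
qed

lemma sum_mset_image_nonneg:
  fixes h :: "'a \<Rightarrow> real"
  assumes "\<And>x. h x \<ge> 0"
  shows "sum_mset (image_mset h A) \<ge> 0"
  by (induction A) (auto simp: assms)

lemma feasible_count_iff: "count A \<in> feasible f \<longleftrightarrow> sum_mset A = f"
proof -
  have "sum_mset A = (\<Sum>p\<in>set_mset A. nat_mult (count A p) p)"
    using sum_mset_image_conv_sum[of "set_mset A" A id] by (simp add: nat_mult_def)
  moreover have "{p. count A p \<noteq> 0} = set_mset A" by auto
  ultimately show ?thesis by (simp add: feasible_def)
qed

lemma valid_iff:
  "valid f \<pi> \<longleftrightarrow> (\<forall>x. \<pi> x \<ge> 0) \<and> (\<forall>A. sum_mset A = f \<longrightarrow> sum_mset (image_mset \<pi> A) \<ge> 1)"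
proof -
  have weight: "(\<Sum>p | count A p \<noteq> 0. \<pi> p * real (count A p)) = sum_mset (image_mset \<pi> A)" for A
  proof -
    have "{p. count A p \<noteq> 0} = set_mset A" by auto
    then show ?thesis
      using sum_mset_image_conv_sum[of "set_mset A" A \<pi>] by (simp add: mult.commute)
  qed
  have "(\<forall>y\<in>feasible f. (\<Sum>p | y p \<noteq> 0. \<pi> p * real (y p)) \<ge> 1) \<longleftrightarrow>
        (\<forall>A. count A \<in> feasible f \<longrightarrow> sum_mset (image_mset \<pi> A) \<ge> 1)" (is "?L = ?R")
  proof
    assume ?L
    then show ?R using weight by metis
  next
    assume R: ?R
    show ?L
    proof
      fix y assume y: "y \<in> feasible f"
      then have "finite {p. 0 < y p}" by (simp add: feasible_def)
      then have "count (Abs_multiset y) = y" by (rule count_Abs_multiset)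
      then show "(\<Sum>p | y p \<noteq> 0. \<pi> p * real (y p)) \<ge> 1"
        using R y weight by metis
    qed
  qed
  then show ?thesis unfolding valid_def feasible_count_iff by blast
qed

text \<open>Otherwise lowering \<open>\<pi> (sum_mset R)\<close> to the right-hand side would keep \<open>\<pi>\<close> valid, since every
  occurrence of \<open>sum_mset R\<close> in a feasible multiset can be replaced by \<open>R\<close>. The empty \<open>R\<close> gives
  \<open>\<pi> 0 = 0\<close>.\<close>

lemma minimal_valid_le_sum:
  assumes "minimal_valid f \<pi>"
  shows "\<pi> (sum_mset R) \<le> sum_mset (image_mset \<pi> R)"
proof (rule ccontr)
  assume less: "\<not> ?thesis"
  define w where "w = sum_mset R"
  define \<pi>' where "\<pi>' = \<pi>(w := sum_mset (image_mset \<pi> R))"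
  have val: "valid f \<pi>" using assms by (simp add: minimal_valid_def)
  have nn: "\<pi> x \<ge> 0" for x using val by (simp add: valid_iff)
  define T where "T A = sum_mset (image_mset (\<lambda>a. if a = w then R else {#a#}) A)" for A
  have T1: "sum_mset (T A) = sum_mset A" for A
    by (induction A) (auto simp: T_def w_def)
  have T2: "sum_mset (image_mset \<pi> (T A)) = sum_mset (image_mset \<pi>' A)" for A
    by (induction A) (auto simp: T_def \<pi>'_def)
  have "valid f \<pi>'"
    unfolding valid_iff
  proof (intro conjI allI impI)
    show "\<pi>' x \<ge> 0" for x
      using nn by (auto simp: \<pi>'_def intro!: sum_mset_image_nonneg)
    show "1 \<le> sum_mset (image_mset \<pi>' A)" if "sum_mset A = f" for A
      using val T1 T2 that by (metis valid_iff)
  qed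
  moreover have "\<pi>' \<noteq> \<pi>" "\<forall>x. \<pi>' x \<le> \<pi> x"
    using less by (auto simp: \<pi>'_def w_def fun_eq_iff)
  ultimately show False using assms by (auto simp: minimal_valid_def)
qed

text \<open>With slack \<open>d\<close> in the symmetry at \<open>x\<close>, the value there could
  be lowered by a small \<open>e\<close>: few copies of \<open>x\<close> cost at most the slack
  \<open>d\<close>, and many copies alone still weigh more than 1.\<close>

lemma minimal_valid_symmetric_le:
  assumes min: "minimal_valid f \<pi>" and pos: "\<pi> x > 0"
  shows "\<pi> x + \<pi> (f - x) \<le> 1"
proof (rule ccontr)
  define d where "d = \<pi> x + \<pi> (f - x) - 1"
  assume "\<not> ?thesis"
  then have d: "d > 0" by (simp add: d_def)
  \<comment> \<open>The second bound makes \<open>n * e > d\<close> imply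
    \<open>n * \<pi> x / 2 > 1\<close>; the first leaves each of the \<open>n\<close> copies at
    least half its weight.\<close>
  define e where "e = min (\<pi> x / 2) (d * \<pi> x / 2)"
  have e: "e > 0" "e \<le> \<pi> x / 2" "e \<le> d * \<pi> x / 2" using d pos by (auto simp: e_def)
  define \<pi>' where "\<pi>' = \<pi>(x := \<pi> x - e)"
  have val: "valid f \<pi>" using min by (simp add: minimal_valid_def)
  have nn: "\<pi> y \<ge> 0" for y using val by (simp add: valid_iff)
  have "valid f \<pi>'"
    unfolding valid_iff
  proof (intro conjI allI impI)
    show "\<pi>' y \<ge> 0" for y
      using nn e pos by (auto simp: \<pi>'_def)
    fix A assume A: "sum_mset A = f"
    define n where "n = count A x"
    define R where "R = filter_mset (\<lambda>y. y \<noteq> x) A"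
    have split: "A = replicate_mset n x + R"
      by (rule multiset_eqI) (auto simp: n_def R_def)
    have "image_mset \<pi>' R = image_mset \<pi> R"
      by (rule image_mset_cong) (auto simp: R_def \<pi>'_def)
    then have sum': "sum_mset (image_mset \<pi>' A) = real n * (\<pi> x - e) + sum_mset (image_mset \<pi> R)"
      by (simp add: split \<pi>'_def)
    have R0: "sum_mset (image_mset \<pi> R) \<ge> 0"
      using nn by (rule sum_mset_image_nonneg)
    show "1 \<le> sum_mset (image_mset \<pi>' A)"
    proof (cases n)
      case 0
      then have "sum_mset (image_mset \<pi> A) = sum_mset (image_mset \<pi>' A)"
        using sum' by (simp add: split)
      then show ?thesis using val A by (metis valid_iff)
    next
      case (Suc k)
      \<comment> \<open>One copy of \<open>x\<close> is set aside; the rest sums to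
        \<open>f - x\<close> and so weighs at least \<open>\<pi> (f - x)\<close>.\<close>
      have "sum_mset (replicate_mset k x + R) = f - x"
        using A by (simp add: split Suc algebra_simps)
      then have "\<pi> (f - x) \<le> real k * \<pi> x + sum_mset (image_mset \<pi> R)"
        using minimal_valid_le_sum[OF min, of "replicate_mset k x + R"] by simp
      then have *: "sum_mset (image_mset \<pi>' A) \<ge> 1 + d - real n * e"
        unfolding sum' by (simp add: Suc d_def algebra_simps)
      show ?thesis
      proof (cases "real n * e \<le> d")
        case True
        then show ?thesis using * by simp
      next
        case False
        moreover have "real n * e \<le> real n * (d * \<pi> x / 2)"
          using e by (intro mult_left_mono) auto
        ultimately have "d * 1 < d * (real n * \<pi> x / 2)" by (simp add: algebra_simps)
        then have "1 < real n * \<pi> x / 2" using d by (simp only: mult_less_cancel_left_pos)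
        moreover have "real n * (\<pi> x - e) \<ge> real n * (\<pi> x / 2)"
          using e by (intro mult_left_mono) auto
        ultimately show ?thesis unfolding sum' using R0 by simp
      qed
    qed
  qed
  moreover have "\<pi>' \<noteq> \<pi>" "\<forall>y. \<pi>' y \<le> \<pi> y"
    using e by (auto simp: \<pi>'_def fun_eq_iff)
  ultimately show False using min by (auto simp: minimal_valid_def)
qed

text \<open>The Gomory--Johnson characterization. In the converse, symmetry leaves no room below
  \<open>\<pi>\<close>: lowering \<open>\<pi> x\<close> or \<open>\<pi> (f - x)\<close> would bring
  their sum below 1.\<close>

theorem minimal_valid_iff:
  assumes "f \<noteq> 0"
  shows "minimal_valid f \<pi> \<longleftrightarrow>
    (\<forall>x. \<pi> x \<ge> 0) \<and> \<pi> 0 = 0 \<and> (\<forall>x y. \<pi> (x + y) \<le> \<pi> x + \<pi> y) \<and> (\<forall>x. \<pi> x + \<pi> (f - x) = 1)"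
    (is "_ \<longleftrightarrow> ?R")
proof
  assume min: "minimal_valid f \<pi>"
  then have val: "valid f \<pi>" by (simp add: minimal_valid_def)
  then have nn: "\<pi> x \<ge> 0" for x by (simp add: valid_iff)
  have "\<pi> 0 = 0" using minimal_valid_le_sum[OF min, of "{#}"] nn[of 0] by simp
  moreover have "\<pi> (x + y) \<le> \<pi> x + \<pi> y" for x y
    using minimal_valid_le_sum[OF min, of "{#x, y#}"] by simp
  moreover have "\<pi> x + \<pi> (f - x) = 1" for x
  proof (rule antisym)
    have "sum_mset {#x, f - x#} = f" by simp
    then have "1 \<le> sum_mset (image_mset \<pi> {#x, f - x#})" using val valid_iff by blast
    then show ge: "1 \<le> \<pi> x + \<pi> (f - x)" by simp
    show "\<pi> x + \<pi> (f - x) \<le> 1"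
    \<comment> \<open>The bound \<open>minimal_valid_symmetric_le\<close> needs a positive value; if
      \<open>\<pi> x = 0\<close>, then \<open>ge\<close> makes \<open>\<pi> (f - x)\<close>
      positive.\<close>
    proof (cases "\<pi> x = 0")
      case True
      then show ?thesis using minimal_valid_symmetric_le[OF min, of "f - x"] ge by simp
    next
      case False
      then show ?thesis using minimal_valid_symmetric_le[OF min, of x] nn[of x] by simp
    qed
  qed
  ultimately show ?R using nn by blast
next
  assume R: ?R
  have le_sum: "\<pi> (sum_mset A) \<le> sum_mset (image_mset \<pi> A)" for A
  proof (induction A)
    case (add x A)
    have "\<pi> (x + sum_mset A) \<le> \<pi> x + \<pi> (sum_mset A)" using R by blast
    then show ?case using add by simp
  qed (use R in simp)
  have "\<pi> 0 + \<pi> (f - 0) = 1" using R by blast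
  then have "\<pi> f = 1" using R by simp
  then have "valid f \<pi>" unfolding valid_iff using R le_sum by metis
  moreover have "\<pi>' = \<pi>" if v: "valid f \<pi>'" and le: "\<forall>x. \<pi>' x \<le> \<pi> x" for \<pi>'
  proof
    fix x
    have "sum_mset {#x, f - x#} = f" by simp
    then have "1 \<le> sum_mset (image_mset \<pi>' {#x, f - x#})" using v valid_iff by blast
    then have "1 \<le> \<pi>' x + \<pi>' (f - x)" by simp
    moreover have "\<pi> x + \<pi> (f - x) = 1" "\<pi>' x \<le> \<pi> x" "\<pi>' (f - x) \<le> \<pi> (f - x)" using R le by auto
    ultimately show "\<pi>' x = \<pi> x" by linarith
  qed
  ultimately show "minimal_valid f \<pi>" unfolding minimal_valid_def by blast
qed

section \<open>The two-slope theorem\<close>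

text \<open>Cauchy's equation: nonnegativity makes \<open>h\<close> monotone, and for
  \<open>t\<close> between consecutive multiples of \<open>d / n\<close> both sides lie in a common
  interval of length \<open>h d / n\<close>.\<close>

lemma additive_nonneg_imp_linear:
  fixes h :: "real \<Rightarrow> real"
  assumes nonneg: "\<And>x. h x \<ge> 0"
    and add: "\<And>x y. 0 \<le> x \<Longrightarrow> 0 \<le> y \<Longrightarrow> x + y \<le> d \<Longrightarrow> h (x + y) = h x + h y"
    and t: "0 \<le> t" "t \<le> d" and "0 < d"
  shows "h t = h d / d * t"
proof -
  have mono: "h x \<le> h y" if "0 \<le> x" "x \<le> y" "y \<le> d" for x y
    using add[of x "y - x"] nonneg[of "y - x"] that by simp
  have h0: "h 0 = 0" using add[of 0 0] \<open>0 < d\<close> by simp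
  have mult: "h (real n * x) = real n * h x" if "0 \<le> x" "real n * x \<le> d" for n x
    using that
  proof (induction n)
    case (Suc n)
    have "real n * x \<le> d" using Suc.prems by (simp add: algebra_simps)
    then show ?case using Suc add[of x "real n * x"] by (simp add: algebra_simps)
  qed (simp add: h0)
  have bound: "\<bar>h t - h d / d * t\<bar> \<le> h d / real n" if n: "n > 0" for n :: nat
  \<comment> \<open>At \<open>t = d\<close> the upper multiple \<open>(k + 1) * (d / n)\<close>
    would exceed \<open>d\<close> and leave the range of additivity.\<close>
  proof (cases "t = d")
    case True
    then show ?thesis using \<open>0 < d\<close> nonneg[of d] by simp
  next
    case False
    have dn: "h (d / real n) = h d / real n"
      using mult[of "d / real n" n] n \<open>0 < d\<close> by (simp add: field_simps)
    define k where "k = nat \<lfloor>real n * t / d\<rfloor>"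
    have k: "real k \<le> real n * t / d" "real n * t / d < real k + 1"
      using t \<open>0 < d\<close> unfolding k_def by (auto simp: le_nat_floor floor_less_iff of_nat_nat)
    have "real n * t / d < real n" using t False n \<open>0 < d\<close> by (simp add: field_simps)
    then have "k < n" using k by linarith
    then have kd: "real (Suc k) * (d / real n) \<le> d"
      using \<open>0 < d\<close> n by (simp add: field_simps mult_right_mono del: of_nat_Suc)
    have ineqs: "real k * (d / real n) \<le> t" "t \<le> real (Suc k) * (d / real n)"
      using k \<open>0 < d\<close> n by (auto simp: field_simps)
    have "real k * (h d / real n) \<le> h t"
      using mult[of "d / real n" k] mono[of "real k * (d / real n)" t] ineqs t \<open>0 < d\<close> dn by simp
    moreover have "h t \<le> real (Suc k) * (h d / real n)"
      using mult[of "d / real n" "Suc k"] mono[of t "real (Suc k) * (d / real n)"] ineqs t kd \<open>0 < d\<close> dn by simp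
    moreover have "real k * (h d / real n) \<le> h d / d * t"
      using mult_right_mono[OF k(1), of "h d / real n"] nonneg[of d] n by (simp add: field_simps)
    moreover have "h d / d * t \<le> real (Suc k) * (h d / real n)"
      using mult_right_mono[OF less_imp_le[OF k(2)], of "h d / real n"] nonneg[of d] n by (simp add: field_simps)
    moreover have "real (Suc k) * (h d / real n) = real k * (h d / real n) + h d / real n"
      by (simp only: of_nat_Suc distrib_right mult_1_left add.commute)
    ultimately show ?thesis by linarith
  qed
  have "(\<lambda>n. h d / real n) \<longlonglongrightarrow> 0" by (rule lim_const_over_n)
  moreover have "\<forall>\<^sub>F n in sequentially. \<bar>h t - h d / d * t\<bar> \<le> h d / real n"
    using eventually_gt_at_top[of 0] by eventually_elim (rule bound)
  ultimately have "\<bar>h t - h d / d * t\<bar> \<le> 0"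
    by (rule tendsto_lowerbound) simp
  then show ?thesis by simp
qed

lemma circle_of_minus: "circle_of (x - y) = circle_of x - circle_of y"
  by transfer simp

lemma circle_of_rep: "circle_of (rep_circle c) = c"
  by (rule Quotient_abs_rep[OF Quotient_circle])

lemma circle_of_int: "circle_of (of_int k) = 0"
  using circle_of_eq_iff[of "of_int k" 0] by (simp add: circle_of_0)

lemma floor_cell:
  fixes x :: real and M :: nat
  assumes "M > 0"
  shows "real_of_int \<lfloor>x * M\<rfloor> / M \<le> x" "x < (real_of_int \<lfloor>x * M\<rfloor> + 1) / M"
  using assms by (auto simp: field_simps) linarith

text \<open>The additivities of \<open>\<phi>\<close> are inherited by \<open>\<phi>1\<close>, so \<open>\<phi>1\<close> is affine wherever \<open>\<phi>\<close> is, and its slope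
  depends only on that of \<open>\<phi>\<close>. Hence \<open>\<phi>1 x = \<alpha> * \<phi> x + \<beta> * x\<close> on the reals; periodicity
  forces \<open>\<beta> = 0\<close>, and the common value at \<open>f\<close> forces \<open>\<alpha> = 1\<close>.\<close>

lemma two_slope_eq:
  fixes \<phi> \<phi>1 \<phi>2 :: "circle \<Rightarrow> real" and M :: nat
  assumes "f \<noteq> 0"
    and min: "minimal_valid f \<phi>" and min1: "minimal_valid f \<phi>1" and min2: "minimal_valid f \<phi>2"
    and avg: "\<And>x. \<phi> x = (\<phi>1 x + \<phi>2 x) / 2"
    and M: "M > 0" and s: "s > 0" and m: "m > 0"
    and right: "\<And>t. 0 \<le> t \<Longrightarrow> t \<le> 1 / M \<Longrightarrow> \<phi> (circle_of t) = s * t"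
    and left: "\<And>t. 0 \<le> t \<Longrightarrow> t \<le> 1 / M \<Longrightarrow> \<phi> (circle_of (- t)) = m * t"
    and cells: "\<And>i::int. \<exists>\<sigma>\<in>{s, - m}. \<forall>x\<in>{i / M..(i + 1) / M}. \<forall>y\<in>{i / M..(i + 1) / M}.
                  \<phi> (circle_of y) - \<phi> (circle_of x) = \<sigma> * (y - x)"
  shows "\<phi>1 = \<phi>"
proof -
  note mv = minimal_valid_iff[OF \<open>f \<noteq> 0\<close>]
  have sub1: "\<phi>1 (x + y) \<le> \<phi>1 x + \<phi>1 y" for x y using min1 mv by blast
  have sub2: "\<phi>2 (x + y) \<le> \<phi>2 x + \<phi>2 y" for x y using min2 mv by blast
  \<comment> \<open>The subadditivity slacks of \<open>\<phi>1\<close> and \<open>\<phi>2\<close>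
    are nonnegative and average to that of \<open>\<phi>\<close>, so both vanish where it
    does.\<close>
  have add: "\<phi>1 (x + y) = \<phi>1 x + \<phi>1 y" if "\<phi> (x + y) = \<phi> x + \<phi> y" for x y
    using sub1[of x y] sub2[of x y] that avg[of x] avg[of y] avg[of "x + y"] by argo
  have addR: "\<phi>1 (circle_of (x + y)) = \<phi>1 (circle_of x) + \<phi>1 (circle_of y)"
    if "\<phi> (circle_of (x + y)) = \<phi> (circle_of x) + \<phi> (circle_of y)" for x y
    using add[of "circle_of x" "circle_of y"] that by (simp add: circle_of_add)
  have nn1: "\<phi>1 x \<ge> 0" for x using min1 mv by blast
  have z: "\<phi> 0 = 0" "\<phi>1 0 = 0" using min min1 mv by blast+
  have "\<phi> 0 + \<phi> (f - 0) = 1" "\<phi>1 0 + \<phi>1 (f - 0) = 1" using min min1 mv by blast+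
  then have one: "\<phi> f = 1" "\<phi>1 f = 1" using z by simp_all
  define d where "d = 1 / real M"
  have d: "d > 0" using M by (simp add: d_def)
  define s1 where "s1 = \<phi>1 (circle_of d) / d"
  define m1 where "m1 = \<phi>1 (circle_of (- d)) / d"
  have right1: "\<phi>1 (circle_of t) = s1 * t" if "0 \<le> t" "t \<le> d" for t
    unfolding s1_def
    by (rule additive_nonneg_imp_linear[OF _ _ that d])
       (auto simp: nn1 right d_def[symmetric] algebra_simps intro!: addR)
  have left1: "\<phi>1 (circle_of (- t)) = m1 * t" if "0 \<le> t" "t \<le> d" for t
    unfolding m1_def
  proof (rule additive_nonneg_imp_linear[where h = "\<lambda>t. \<phi>1 (circle_of (- t))", OF _ _ that d])
    fix x y :: real assume "0 \<le> x" "0 \<le> y" "x + y \<le> d"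
    then show "\<phi>1 (circle_of (- (x + y))) = \<phi>1 (circle_of (- x)) + \<phi>1 (circle_of (- y))"
      using addR[of "- x" "- y"] left[of x] left[of y] left[of "x + y"]
      by (simp add: d_def[symmetric] algebra_simps)
  qed (rule nn1)
  \<comment> \<open>\<open>\<alpha>\<close> and \<open>\<beta>\<close> solve
    \<open>s1 = \<alpha> * s + \<beta>\<close> and \<open>- m1 = \<alpha> * (- m) + \<beta>\<close>,
    so that \<open>h\<close> has slope 0 on every cell.\<close>
  define \<alpha> where "\<alpha> = (s1 + m1) / (s + m)"
  define \<beta> where "\<beta> = s1 - \<alpha> * s"
  have "\<alpha> * (s + m) = s1 + m1" using s m by (simp add: \<alpha>_def)
  then have \<beta>': "- m1 = \<alpha> * (- m) + \<beta>" by (simp add: \<beta>_def algebra_simps)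
  define h where "h x = \<phi>1 (circle_of x) - \<alpha> * \<phi> (circle_of x) - \<beta> * x" for x
  have const: "h x = h (i / M)" if x: "x \<in> {i / M..(i + 1) / M}" for i :: int and x
  proof -
    define a where "a = real_of_int i / M"
    define b where "b = real_of_int (i + 1) / M"
    have ab: "b = a + d" by (simp add: a_def b_def d_def add_divide_distrib)
    have x': "a \<le> x" "x \<le> b" using x by (auto simp: a_def b_def)
    from cells[of i] obtain \<sigma> where \<sigma>: "\<sigma> = s \<or> \<sigma> = - m"
      and cell: "\<forall>x\<in>{a..b}. \<forall>y\<in>{a..b}. \<phi> (circle_of y) - \<phi> (circle_of x) = \<sigma> * (y - x)"
      unfolding a_def b_def by blast
    have lin: "\<phi> (circle_of y) - \<phi> (circle_of x) = \<sigma> * (y - x)"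
      if "a \<le> x" "x \<le> b" "a \<le> y" "y \<le> b" for x y
      using cell that by simp
    from \<sigma> have "h x = h a"
    proof
      assume "\<sigma> = s"
      then have e: "\<phi> (circle_of x) = \<phi> (circle_of a) + s * (x - a)" using lin[of a x] x' by auto
      then have e1: "\<phi>1 (circle_of x) = \<phi>1 (circle_of a) + s1 * (x - a)"
        using addR[of a "x - a"] right[of "x - a"] right1[of "x - a"] x' ab by (simp add: d_def)
      show ?thesis unfolding h_def e e1 by (simp add: \<beta>_def algebra_simps)
    next
      assume sm: "\<sigma> = - m"
      \<comment> \<open>On a falling cell the additivity used is \<open>y = b + (y - b)\<close>,
        based at the right end, because \<open>\<phi>\<close> has slope \<open>- m\<close> to the
        left of 0.\<close>
      have *: "\<phi>1 (circle_of y) = \<phi>1 (circle_of b) + m1 * (b - y)"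
        "\<phi> (circle_of y) = \<phi> (circle_of b) + m * (b - y)" if "a \<le> y" "y \<le> b" for y
      proof -
        show e: "\<phi> (circle_of y) = \<phi> (circle_of b) + m * (b - y)"
          using lin[of b y] that sm ab d by (simp add: algebra_simps)
        then show "\<phi>1 (circle_of y) = \<phi>1 (circle_of b) + m1 * (b - y)"
          using addR[of b "y - b"] left[of "b - y"] left1[of "b - y"] that ab by (simp add: d_def)
      qed
      have m1: "m1 = \<alpha> * m - \<beta>" using \<beta>' by simp
      have "h y = \<phi>1 (circle_of b) - \<alpha> * \<phi> (circle_of b) - \<beta> * b" if "a \<le> y" "y \<le> b" for y
        unfolding h_def *[OF that] m1 by (simp add: algebra_simps)
      then show ?thesis using x' by simp
    qed
    then show ?thesis by (simp add: a_def)
  qed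
  have step: "h ((i + 1) / M) = h (i / M)" for i :: int
    using const[of "(i + 1) / M" i] M by (simp add: divide_right_mono)
  have grid: "h (i / M) = h 0" for i :: int
  proof (induction i rule: int_induct[of _ 0])
    case (step1 i)
    then show ?case using step[of i] by simp
  next
    case (step2 i)
    then show ?case using step[of "i - 1"] by simp
  qed simp
  have zero: "h x = 0" for x
  proof -
    have "h x = h (\<lfloor>x * M\<rfloor> / M)"
      by (rule const) (use floor_cell[OF M, of x] in auto)
    then show ?thesis using grid z by (simp add: h_def circle_of_0)
  qed
  have "h 1 = 0" by (rule zero)
  then have b: "\<beta> = 0" using z circle_of_int[of 1] by (simp add: h_def)
  have "h (rep_circle f) = 0" by (rule zero)
  then have a: "\<alpha> = 1" using one b by (simp add: h_def circle_of_rep)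
  show ?thesis
  proof
    fix c
    show "\<phi>1 c = \<phi> c" using zero[of "rep_circle c"] a b by (simp add: h_def circle_of_rep)
  qed
qed

theorem two_slope_extreme:
  fixes \<phi> :: "circle \<Rightarrow> real" and M :: nat
  assumes "f \<noteq> 0" "minimal_valid f \<phi>" "M > 0" "s > 0" "m > 0"
    and "\<And>t. 0 \<le> t \<Longrightarrow> t \<le> 1 / M \<Longrightarrow> \<phi> (circle_of t) = s * t"
    and "\<And>t. 0 \<le> t \<Longrightarrow> t \<le> 1 / M \<Longrightarrow> \<phi> (circle_of (- t)) = m * t"
    and "\<And>i::int. \<exists>\<sigma>\<in>{s, - m}. \<forall>x\<in>{i / M..(i + 1) / M}. \<forall>y\<in>{i / M..(i + 1) / M}.
           \<phi> (circle_of y) - \<phi> (circle_of x) = \<sigma> * (y - x)"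
  shows "extreme f \<phi>"
  unfolding extreme_def
proof (intro conjI allI impI)
  fix \<phi>1 \<phi>2
  assume 1: "minimal_valid f \<phi>1" and 2: "minimal_valid f \<phi>2" and avg: "\<forall>x. \<phi> x = (\<phi>1 x + \<phi>2 x) / 2"
  show "\<phi> = \<phi>1"
    using two_slope_eq[OF assms(1,2) 1 2 _ assms(3-8)] avg by metis
  show "\<phi> = \<phi>2"
    using two_slope_eq[OF assms(1,2) 2 1 _ assms(3-8)] avg by (metis add.commute)
qed (rule assms)

section \<open>The symmetrized fill-in\<close>

lemma common_denominator:
  fixes A :: "real set"
  assumes "finite A" "A \<subseteq> \<rat>"
  obtains M :: nat where "M > 0" "\<And>a. a \<in> A \<Longrightarrow> a * real M \<in> \<int>"
proof -
  have "\<exists>M::nat. M > 0 \<and> (\<forall>a\<in>A. a * real M \<in> \<int>)"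
    using assms
  proof (induction A)
    case (insert x A)
    then obtain M :: nat where M: "M > 0" "\<forall>a\<in>A. a * real M \<in> \<int>" by auto
    obtain i :: int and n :: nat where x: "x = i / n" "n \<noteq> 0"
      using insert.prems by (auto simp: Rats_eq_int_div_nat)
    show ?case
    proof (intro exI[of _ "M * n"] conjI ballI)
      fix a assume "a \<in> insert x A"
      then consider "a = x" | "a \<in> A" by auto
      then show "a * real (M * n) \<in> \<int>"
      proof cases
        case 1
        have "x * real (M * n) = of_int (i * int M)" using x by simp
        then show ?thesis using 1 by (metis Ints_of_int)
      next
        case 2
        then have "(a * real M) * real n \<in> \<int>" using M by (blast intro: Ints_mult Ints_of_nat)
        then show ?thesis by (simp add: mult.assoc)
      qed
    qed (use M x in auto)
  qed auto
  then show ?thesis using that by blast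
qed

text \<open>Two grids: the coarse \<open>1 / q\<close>, on whose cells next to 0 \<open>p\<close> is
  linear, and the fine \<open>1 / N\<close> of the fill-in. By \<open>2 * q dvd N\<close> coarse
  grid points have even fine indices. \<open>low0\<close> makes the cells near 0 low,
  \<open>\<mu>\<close> is the slack of \<open>p\<close> away from its zeros, and \<open>rat\<close>
  yields rational breakpoints.\<close>

locale fill_in =
  fixes p :: "real \<Rightarrow> real" and r s m \<mu> :: real and q N :: nat and R :: int
  assumes nonneg: "p x \<ge> 0"
    and zero: "p 0 = 0"
    and per: "p (x + 1) = p x"
    and sub: "p (x + y) \<le> p x + p y"
    and sym: "p x + p (r - x) = 1"
    and q: "q > 0" and N: "N > 0" and qN: "2 * q dvd N"
    and R: "r * N = of_int R" and R_even: "even R"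
    and s: "s > 0" and m: "m > 0"
    and right: "0 \<le> t \<Longrightarrow> t \<le> 1 / q \<Longrightarrow> p t = s * t"
    and left: "0 \<le> t \<Longrightarrow> t \<le> 1 / q \<Longrightarrow> p (- t) = m * t"
    and low0: "s / q < 1 / 2" "m / q < 1 / 2"
    and away: "p (of_int i / q) \<noteq> 0 \<Longrightarrow> p (of_int (i + 1) / q) \<noteq> 0 \<Longrightarrow>
        of_int i / q \<le> x \<Longrightarrow> x \<le> of_int (i + 1) / q \<Longrightarrow> \<mu> \<le> p x"
    and \<mu>: "\<mu> \<le> 1" "5 * ((s + m) / N) \<le> \<mu>"
    and rat: "s \<in> \<rat>" "m \<in> \<rat>" "\<And>i::int. p (i / N) \<in> \<rat>"
begin

section \<open>The gauge \<open>g\<close> and the growth of \<open>p\<close>\<close>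

definition g :: "real \<Rightarrow> real" where "g t = max (s * t) (- m * t)"

lemma g_pos: "t \<ge> 0 \<Longrightarrow> g t = s * t"
  unfolding g_def using s m mult_nonneg_nonneg[of s t] mult_nonneg_nonneg[of m t]
  by (intro max_absorb1) linarith

lemma g_neg: "t \<le> 0 \<Longrightarrow> g t = - m * t"
  unfolding g_def using s m mult_nonneg_nonpos[of s t] mult_nonneg_nonpos[of m t]
  by (intro max_absorb2) linarith

lemma g_0: "g 0 = 0" by (simp add: g_def)

lemma g_sub: "g (a + b) \<le> g a + g b"
  by (simp add: g_def max_def algebra_simps)

lemma g_le: "g t \<le> (s + m) * \<bar>t\<bar>"
proof (cases "t \<ge> 0")
  case True
  then show ?thesis using m by (simp add: g_pos algebra_simps)
next
  case False
  then show ?thesis using s mult_pos_neg[of s t] by (simp add: g_neg algebra_simps)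
qed

lemma p_near0: "\<bar>t\<bar> \<le> 1 / q \<Longrightarrow> p t = g t"
  using right[of t] left[of "- t"] g_pos[of t] g_neg[of t] by (cases "t \<ge> 0") auto

text \<open>Walk from \<open>x\<close> to \<open>x + t\<close> in \<open>n\<close> equal steps short
  enough for \<open>p\<close> to coincide with \<open>g\<close>; as \<open>g\<close> is positively
  homogeneous, the increments add up to \<open>g t\<close>. The \<open>+ 1\<close> keeps
  \<open>n\<close> positive at \<open>t = 0\<close>.\<close>

lemma p_lip: "p (x + t) \<le> p x + g t"
proof -
  define n where "n = nat \<lceil>\<bar>t\<bar> * q\<rceil> + 1"
  define u where "u = t / n"
  have n: "n > 0" "\<bar>t\<bar> * q \<le> n" by (auto simp: n_def) linarith
  have u: "\<bar>u\<bar> \<le> 1 / q" using n q by (simp add: u_def field_simps)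
  have "p (x + real k * u) \<le> p x + real k * g u" for k
  proof (induction k)
    case (Suc k)
    have "p ((x + real k * u) + u) \<le> p (x + real k * u) + g u"
      using sub[of "x + real k * u" u] p_near0[OF u] by simp
    then show ?case using Suc by (simp add: algebra_simps)
  qed simp
  from this[of n] have "p (x + t) \<le> p x + real n * g u" using n by (simp add: u_def)
  also have "real n * g u = g t"
    using n by (simp add: g_def u_def max_mult_distrib_left)
  finally show ?thesis .
qed

lemma p_lip': "p y \<le> p x + g (y - x)"
  using p_lip[of x "y - x"] by simp

lemma p_int: "p (x + of_int k) = p x"
proof (induction k rule: int_induct[of _ 0])
  case (step1 i)
  then show ?case using per[of "x + of_int i"] by (simp add: add.assoc)
next
  case (step2 i)
  then show ?case using per[of "x + of_int (i - 1)"] by simp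
qed simp

lemma p_mult: "p (real n * x) \<le> real n * p x"
proof (induction n)
  case (Suc n)
  then show ?case using sub[of x "real n * x"] by (simp add: algebra_simps)
qed (simp add: zero)

text \<open>Modulo 1, \<open>- (k / N)\<close> is the multiple \<open>(N - 1) * (k / N)\<close>, and
  subadditivity passes a zero on to its multiples. Hence zeros on the grid are periods of
  \<open>p\<close>.\<close>

lemma p_zero_minus:
  assumes "p (of_int k / N) = 0"
  shows "p (- (of_int k / N)) = 0"
proof -
  have "real (N - 1) * (of_int k / N) = - (of_int k / N) + of_int k"
    using N by (simp add: of_nat_diff field_simps)
  then have "p (- (of_int k / N)) = p (real (N - 1) * (of_int k / N))"
    by (simp only: p_int)
  also have "\<dots> \<le> 0"
    using p_mult[of "N - 1" "of_int k / N"] assms by simp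
  finally have "p (- (of_int k / N)) \<le> 0" .
  then show ?thesis using nonneg by (simp add: antisym)
qed

lemma p_shift:
  assumes "p (of_int k / N) = 0"
  shows "p (x + of_int k / N) = p x"
  using sub[of x "of_int k / N"] sub[of "x + of_int k / N" "- (of_int k / N)"] assms p_zero_minus[OF assms]
  by simp

section \<open>The fill-in \<open>F\<close>\<close>

lemma cell_cases: obtains j :: int where "of_int j / N \<le> x" "x \<le> of_int (j + 1) / N"
  using floor_cell[OF N, of x] by fastforce

definition E :: "int \<Rightarrow> real \<Rightarrow> real" where
  "E j x = min (p (j / N) + s * (x - j / N)) (p ((j + 1) / N) + m * ((j + 1) / N - x))"

text \<open>Only the two ends of the cell of \<open>x\<close> matter in the fill-in: for a grid
  point \<open>u / N\<close> farther out, \<open>g (x - u / N)\<close> splits additively at the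
  nearer end, and \<open>p_lip'\<close> bounds \<open>p\<close> at that end.\<close>

lemma E_le:
  fixes j u :: int
  assumes "j / N \<le> x" "x \<le> (j + 1) / N"
  shows "E j x \<le> p (u / N) + g (x - u / N)"
proof (cases "u \<le> j")
  case True
  then have "real_of_int u / N \<le> j / N" using N by (simp add: divide_right_mono)
  then have "p (j / N) + s * (x - j / N) \<le> p (u / N) + g (x - u / N)"
    using p_lip'[of "j / N" "u / N"] assms
    by (simp add: g_pos algebra_simps)
  then show ?thesis by (simp add: E_def)
next
  case False
  define b where "b = (j + 1) / N"
  have "b \<le> real_of_int u / N" using False N by (simp add: b_def divide_right_mono)
  moreover have "x \<le> b" using assms by (simp add: b_def)
  ultimately have "p b + m * (b - x) \<le> p (u / N) + g (x - u / N)"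
    using p_lip'[of b "u / N"] by (simp add: g_neg algebra_simps)
  then show ?thesis by (simp add: E_def b_def)
qed

lemma E_attained:
  fixes j :: int
  assumes "j / N \<le> x" "x \<le> (j + 1) / N"
  shows "\<exists>u::int. E j x = p (u / N) + g (x - u / N)"
proof (cases "p (j / N) + s * (x - j / N) \<le> p ((j + 1) / N) + m * ((j + 1) / N - x)")
  case True
  then show ?thesis using assms by (intro exI[of _ j]) (simp add: E_def g_pos)
next
  case False
  have "g (x - (j + 1) / N) = m * ((j + 1) / N - x)"
    using assms by (subst g_neg) (auto simp only: mult_minus_left mult_minus_right[symmetric] minus_diff_eq)
  then show ?thesis using False by (intro exI[of _ "j + 1"]) (simp add: E_def)
qed

definition F :: "real \<Rightarrow> real" where "F x = E \<lfloor>x * N\<rfloor> x"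

lemma F_le: "F x \<le> p (of_int u / N) + g (x - of_int u / N)"
  unfolding F_def using floor_cell[OF N, of x] by (intro E_le) auto

lemma F_attained: "\<exists>u::int. F x = p (u / N) + g (x - u / N)"
  unfolding F_def using floor_cell[OF N, of x] by (intro E_attained) auto

text \<open>Both sides are the least of the values \<open>p (u / N) + g (x - u / N)\<close>, so they
  agree even at the right end, where the floor selects the next cell.\<close>

lemma F_cell:
  fixes j :: int
  assumes "j / N \<le> x" "x \<le> (j + 1) / N"
  shows "F x = E j x"
  by (metis E_attained[OF assms] E_le[OF assms] F_attained F_le antisym)

lemma F_ge: "p x \<le> F x"
  using F_attained[of x] p_lip' by metis

lemma F_grid: "F (of_int u / N) = p (of_int u / N)"
  using F_le[of "of_int u / N" u] F_ge[of "of_int u / N"] by (simp add: g_0)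

text \<open>Grid points are closed under addition, so the sum of the two minimizers competes in the
  minimum for \<open>F (x + y)\<close>.\<close>

lemma F_sub: "F (x + y) \<le> F x + F y"
proof -
  obtain u v :: int where u: "F x = p (u / N) + g (x - u / N)" and v: "F y = p (v / N) + g (y - v / N)"
    using F_attained by metis
  have "F (x + y) \<le> p (of_int (u + v) / N) + g (x + y - of_int (u + v) / N)" by (rule F_le)
  also have "\<dots> \<le> F x + F y"
    using sub[of "u / N" "v / N"] g_sub[of "x - u / N" "y - v / N"] u v
    by (simp add: add_divide_distrib algebra_simps)
  finally show ?thesis .
qed

lemma F_lip: "F y \<le> F x + g (y - x)"
proof -
  obtain u :: int where u: "F x = p (u / N) + g (x - u / N)" using F_attained by metis
  have "F y \<le> p (u / N) + g (y - u / N)" by (rule F_le)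
  also have "\<dots> \<le> F x + g (y - x)" using g_sub[of "x - u / N" "y - x"] u by simp
  finally show ?thesis .
qed

lemma F_upper: "F x \<le> p x + (s + m) / N"
proof -
  define a where "a = real_of_int \<lfloor>x * N\<rfloor> / N"
  have a: "a \<le> x" "x < a + 1 / N"
    using floor_cell[OF N, of x] by (auto simp: a_def add_divide_distrib)
  have "F x \<le> p a + g (x - a)" unfolding a_def by (rule F_le)
  also have "p a \<le> p x + g (a - x)" by (rule p_lip')
  also have "g (x - a) \<le> s * (1 / N)" 
    using a s mult_left_mono[of "x - a" "1 / N" s] by (simp add: g_pos)
  also have "g (a - x) \<le> m * (1 / N)" 
    using a m mult_left_mono[of "x - a" "1 / N" m] by (simp add: g_neg algebra_simps)
  finally show ?thesis by (simp add: add_divide_distrib)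
qed

lemma F_shift:
  assumes "p (of_int k / N) = 0"
  shows "F (x + of_int k / N) = F x"
  using F_sub[of x "of_int k / N"] F_sub[of "x + of_int k / N" "- (of_int k / N)"]
    F_grid[of k] F_grid[of "- k"] assms p_zero_minus[OF assms]
  by simp

section \<open>The symmetrization \<open>\<phi>\<close>\<close>

lemma grid_reflect: "r - of_int u / N = of_int (R - u) / N"
  using R N by (simp add: field_simps)

text \<open>On cells where \<open>p\<close> takes the value \<open>1/2\<close> at the midpoint, the parity makes the choice
  compatible with the reflection \<open>x \<mapsto> r - x\<close> (which changes the parity of the cell, as \<open>R\<close> is
  even) and with the periods \<open>k / N\<close> of \<open>p\<close> (for which \<open>k\<close> is even).\<close>

definition low :: "int \<Rightarrow> bool" where
  "low j \<longleftrightarrow> p ((j + 1 / 2) / N) < 1 / 2 \<or> p ((j + 1 / 2) / N) = 1 / 2 \<and> even j"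

definition \<phi> :: "real \<Rightarrow> real" where
  "\<phi> x = (if low \<lfloor>x * N\<rfloor> then F x else 1 - F (r - x))"

lemma Fstar_grid: "1 - F (r - of_int u / N) = p (of_int u / N)"
  using sym[of "of_int u / N"] F_grid[of "R - u"] by (simp add: grid_reflect)

text \<open>Both branches equal \<open>p\<close> on the grid, so the choice made for a cell is also
  correct at its right end.\<close>

lemma \<phi>_cell:
  fixes j :: int
  assumes "j / N \<le> x" "x \<le> (j + 1) / N"
  shows "\<phi> x = (if low j then F x else 1 - F (r - x))"
proof (cases "x = (j + 1) / N")
  case True
  then have "x = of_int (j + 1) / N" by simp
  then show ?thesis using F_grid[of "j + 1"] Fstar_grid[of "j + 1"] by (simp only: \<phi>_def if_cancel)
next
  case False
  then have "\<lfloor>x * N\<rfloor> = j" using assms N by (intro floor_unique) (auto simp: field_simps)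
  then show ?thesis by (simp add: \<phi>_def)
qed

lemma \<phi>_grid: "\<phi> (of_int u / N) = p (of_int u / N)"
  by (simp only: \<phi>_def F_grid Fstar_grid if_cancel)

lemma low_reflect: "low (R - 1 - j) \<longleftrightarrow> \<not> low j"
proof -
  have "r - (of_int j + 1 / 2) / N = (of_int (R - 1 - j) + 1 / 2) / N"
    using R N by (simp add: field_simps)
  then have "p ((of_int j + 1 / 2) / N) + p ((of_int (R - 1 - j) + 1 / 2) / N) = 1"
    using sym[of "(of_int j + 1 / 2) / N"] by simp
  then show ?thesis using R_even by (auto simp: low_def)
qed

lemma low_shift:
  assumes "p (of_int k / N) = 0" "even k"
  shows "low (j + k) \<longleftrightarrow> low j"
proof -
  have "p ((of_int (j + k) + 1 / 2) / N) = p ((of_int j + 1 / 2) / N)"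
    using p_shift[OF assms(1), of "(of_int j + 1 / 2) / N"] by (simp add: add_divide_distrib algebra_simps)
  then show ?thesis using assms by (simp add: low_def)
qed

lemma \<phi>_symmetric: "\<phi> x + \<phi> (r - x) = 1"
proof -
  obtain j :: int where j: "j / N \<le> x" "x \<le> (j + 1) / N" by (rule cell_cases[of x])
  have "of_int (R - 1 - j) / N \<le> r - x" "r - x \<le> (of_int (R - 1 - j) + 1) / N"
    using j R N by (auto simp: field_simps)
  then show ?thesis using \<phi>_cell[OF j] \<phi>_cell[of "R - 1 - j" "r - x"] low_reflect[of j] by simp
qed

lemma \<phi>_shift:
  assumes "p (of_int k / N) = 0" "even k"
  shows "\<phi> (x + of_int k / N) = \<phi> x"
proof -
  have "(x + of_int k / N) * N = x * N + of_int k" using N by (simp add: field_simps)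
  then have fl: "\<lfloor>(x + of_int k / N) * N\<rfloor> = \<lfloor>x * N\<rfloor> + k" by simp
  have "F (r - (x + of_int k / N)) = F (r - x)"
    using F_shift[OF assms(1), of "r - (x + of_int k / N)"] by simp
  then show ?thesis unfolding \<phi>_def fl by (simp add: F_shift low_shift assms)
qed

lemma \<phi>_lip_cell:
  fixes j :: int
  assumes "j / N \<le> x" "x \<le> (j + 1) / N" "j / N \<le> y" "y \<le> (j + 1) / N"
  shows "\<phi> y \<le> \<phi> x + g (y - x)"
  using \<phi>_cell[OF assms(1,2)] \<phi>_cell[OF assms(3,4)] F_lip[of y x] F_lip[of "r - x" "r - y"] by simp

text \<open>Within a cell this is the bound for \<open>F\<close>, possibly reflected; between grid
  points it is the one for \<open>p\<close>. The path from \<open>x\<close> to \<open>y\<close> is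
  monotone, so \<open>g\<close> adds up along it.\<close>

lemma \<phi>_lip: "\<phi> y \<le> \<phi> x + g (y - x)"
proof -
  obtain i :: int where i: "i / N \<le> x" "x \<le> (i + 1) / N" by (rule cell_cases[of x])
  obtain j :: int where j: "j / N \<le> y" "y \<le> (j + 1) / N" by (rule cell_cases[of y])
  have via: "\<phi> y \<le> \<phi> x + g (u / N - x) + g (v / N - u / N) + g (y - v / N)"
    if "\<phi> (u / N) \<le> \<phi> x + g (u / N - x)" "\<phi> y \<le> \<phi> (v / N) + g (y - v / N)" for u v :: int
    using that p_lip'[of "v / N" "u / N"] \<phi>_grid[of u] \<phi>_grid[of v] by simp
  consider "i = j" | "i < j" | "j < i" by linarith
  then show ?thesis
  proof cases
    case 1
    then show ?thesis using \<phi>_lip_cell i j by blast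
  next
    case 2
    have o: "x \<le> of_int (i + 1) / N" "of_int (i + 1) / N \<le> of_int j / real N"
      using 2 i N by (auto simp: divide_right_mono)
    have "\<phi> y \<le> \<phi> x + g (of_int (i + 1) / N - x) + g (of_int j / N - of_int (i + 1) / N) + g (y - of_int j / N)"
      using i j N by (intro via \<phi>_lip_cell[of i] \<phi>_lip_cell[of j]) (auto simp: divide_right_mono)
    also have "\<dots> = \<phi> x + g (y - x)"
      using o j by (simp add: g_pos algebra_simps del: of_int_add)
    finally show ?thesis .
  next
    case 3
    have o: "y \<le> of_int (j + 1) / N" "of_int (j + 1) / N \<le> of_int i / real N"
      using 3 j N by (auto simp: divide_right_mono)
    have "\<phi> y \<le> \<phi> x + g (of_int i / N - x) + g (of_int (j + 1) / N - of_int i / N) + g (y - of_int (j + 1) / N)"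
      using i j N by (intro via \<phi>_lip_cell[of i] \<phi>_lip_cell[of j]) (auto simp: divide_right_mono)
    also have "\<dots> = \<phi> x + g (y - x)"
      using o i by (simp add: g_neg algebra_simps del: of_int_add)
    finally show ?thesis .
  qed
qed

text \<open>By \<open>low0\<close> the cells here are low, and \<open>F\<close> is squeezed between
  \<open>p t = g t\<close> and the contribution \<open>g t\<close> of the grid point 0.\<close>

lemma \<phi>_near0:
  assumes "\<bar>t\<bar> \<le> 1 / q"
  shows "\<phi> t = g t"
proof -
  obtain K where "N = 2 * q * K" using qN by (rule dvdE)
  then have K: "N = q * (2 * K)" by simp
  have K0: "K > 0" using K N by (cases K) auto
  have q1: "1 / q = real_of_int (2 * int K) / N" using q K K0 by (simp add: field_simps)
  show ?thesis
  \<comment> \<open>At \<open>t = 1 / q\<close> the floor selects a cell outside the interval, but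
    this point lies on the grid.\<close>
  proof (cases "t = 1 / q")
    case True
    then show ?thesis using p_near0[OF assms] \<phi>_grid[of "2 * int K"] q1 by simp
  next
    case False
    define j where "j = \<lfloor>t * N\<rfloor>"
    have j: "j / N \<le> t" "t \<le> (j + 1) / N" using floor_cell[OF N, of t] by (auto simp: j_def)
    have tN: "\<bar>t * N\<bar> \<le> 2 * real K" "t * N < 2 * real K"
    proof -
      have "\<bar>t\<bar> \<le> 2 * real K / N" "t < 2 * real K / N" using assms False q1 by auto
      then show "\<bar>t * N\<bar> \<le> 2 * real K" "t * N < 2 * real K"
        using N by (simp_all add: abs_mult pos_le_divide_eq pos_less_divide_eq)
    qed
    have "- (2 * real K) \<le> t * N" using tN(1) by linarith
    then have "- (2 * int K) \<le> j" by (simp add: j_def le_floor_iff)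
    moreover have "j < 2 * int K" using tN(2) by (simp add: j_def floor_less_iff)
    ultimately have b: "- (2 * real K) \<le> real_of_int j" "real_of_int j + 1 \<le> 2 * real K" by linarith+
    define c where "c = (real_of_int j + 1 / 2) / N"
    have c: "\<bar>c\<bar> \<le> 1 / q"
      using b N unfolding q1 c_def by (auto simp: abs_le_iff field_simps)
    have "p c = g c" using p_near0[OF c] .
    also have "g c \<le> max (s / q) (m / q)"
    proof (cases "c \<ge> 0")
      case True
      then show ?thesis using c s mult_left_mono[of c "1 / q" s] by (simp add: g_pos)
    next
      case False
      then show ?thesis using c m mult_left_mono[of "- c" "1 / q" m] by (simp add: g_neg)
    qed
    also have "\<dots> < 1 / 2" using low0 by simp
    finally have "low j" by (simp add: low_def c_def)
    then have "\<phi> t = F t" using \<phi>_cell[OF j] by simp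
    also have "F t = g t"
      using F_le[of t 0] F_ge[of t] p_near0[OF assms] by (simp add: zero)
    finally show ?thesis .
  qed
qed

lemma \<phi>_ge: "p x - (s + m) / N \<le> \<phi> x" and \<phi>_le: "\<phi> x \<le> p x + (s + m) / N"
  using F_ge[of x] F_upper[of x] F_ge[of "r - x"] F_upper[of "r - x"] sym[of x] s m N
    divide_nonneg_nonneg[of "s + m" N]
  by (auto simp: \<phi>_def)

text \<open>On a high cell \<open>p\<close> is at least \<open>1/2\<close> at the midpoint, and by
  \<open>p_lip'\<close> it can fall short of that by at most \<open>(s + m) / N\<close> elsewhere in
  the cell.\<close>

lemma \<phi>_low_or_high:
  obtains "\<phi> x = F x" | "\<phi> x = 1 - F (r - x)" "p x \<ge> 1 / 2 - (s + m) / N"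
proof -
  obtain j :: int where j: "j / N \<le> x" "x \<le> (j + 1) / N" by (rule cell_cases[of x])
  show ?thesis
  proof (cases "low j")
    case True
    then show ?thesis using that(1) \<phi>_cell[OF j] by simp
  next
    case False
    define c where "c = (of_int j + 1 / 2) / real N"
    have "p c \<ge> 1 / 2" using False by (auto simp: low_def c_def not_less)
    moreover have "p c \<le> p x + g (c - x)" by (rule p_lip')
    moreover have "\<bar>c - x\<bar> \<le> 1 / N" using j N by (auto simp: c_def field_simps abs_le_iff)
    then have "g (c - x) \<le> (s + m) * (1 / N)"
      using g_le[of "c - x"] s m mult_left_mono[of "\<bar>c - x\<bar>" "1 / N" "s + m"] by linarith
    ultimately have "p x \<ge> 1 / 2 - (s + m) / N" by simp
    then show ?thesis using that(2) \<phi>_cell[OF j] False by simp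
  qed
qed

section \<open>Nonnegativity and subadditivity of \<open>\<phi>\<close>\<close>

lemma \<phi>_nonneg: "\<phi> x \<ge> 0"
proof (cases rule: \<phi>_low_or_high[of x])
  case 1
  then show ?thesis using F_ge[of x] nonneg[of x] by simp
next
  case 2
  \<comment> \<open>\<open>\<mu>\<close> gives \<open>(s + m) / N \<le> 1 / 5\<close>, which keeps
    \<open>1 / 2 - 2 * ((s + m) / N)\<close> positive.\<close>
  then show ?thesis using \<phi>_ge[of x] \<mu> by linarith
qed

text \<open>The coarse cell of \<open>z\<close> either has a zero of \<open>p\<close> at an end,
  whose fine index is a multiple of \<open>2 * K\<close>, or falls under
  \<open>away\<close>.\<close>

lemma near_or_away:
  obtains k :: int and t where "z = of_int k / N + t" "even k" "p (of_int k / N) = 0" "\<bar>t\<bar> \<le> 1 / q"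
  | "\<mu> \<le> p z"
proof -
  obtain K where "N = 2 * q * K" using qN by (rule dvdE)
  then have K: "N = q * (2 * K)" by simp
  define i where "i = \<lfloor>z * q\<rfloor>"
  have i: "i / q \<le> z" "z \<le> (i + 1) / q" using floor_cell[OF q, of z] by (auto simp: i_def)
  have grid: "real_of_int (u * (2 * int K)) / N = u / q" for u
    using K N q by (simp add: field_simps)
  consider "p (i / q) = 0" | "p (of_int (i + 1) / q) = 0" | "p (i / q) \<noteq> 0" "p (of_int (i + 1) / q) \<noteq> 0"
    by blast
  then show ?thesis
  proof cases
    case 1
    then show ?thesis using i
      by (intro that(1)[of "i * (2 * int K)" "z - i / q"])
        (unfold grid, auto simp: add_divide_distrib abs_le_iff)
  next
    case 2
    then show ?thesis using i
      by (intro that(1)[of "(i + 1) * (2 * int K)" "z - of_int (i + 1) / q"])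
        (unfold grid, auto simp: add_divide_distrib abs_le_iff)
  next
    case 3
    then show ?thesis using away[OF 3] i that(2) by simp
  qed
qed

text \<open>The period \<open>k / N\<close> moves \<open>z\<close> to \<open>t\<close>, where
  \<open>\<phi>\<close> is \<open>g\<close>. By symmetry
  \<open>\<phi> y = 1 - \<phi> (x + t)\<close>, so the claim becomes
  \<open>\<phi> (x + t) \<le> \<phi> x + g t\<close>.\<close>

lemma \<phi>_triple_near:
  assumes "x + y + z = r" "even k" "p (of_int k / N) = 0" "z = of_int k / N + t" "\<bar>t\<bar> \<le> 1 / q"
  shows "\<phi> x + \<phi> y + \<phi> z \<ge> 1"
proof -
  have "x + z = (x + t) + of_int k / N" using assms(4) by simp
  then have "\<phi> (x + z) = \<phi> (x + t)" by (simp only: \<phi>_shift[OF assms(3,2)])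
  moreover have "\<phi> z = g t"
    using \<phi>_shift[OF assms(3,2), of t] assms(4) \<phi>_near0[OF assms(5)] by (simp add: add.commute)
  moreover have "\<phi> (x + t) \<le> \<phi> x + g t" using \<phi>_lip[of "x + t" x] by simp
  moreover have "\<phi> y = 1 - \<phi> (x + z)" 
  proof -
    have "x + z = r - y" using assms(1) by simp
    then show ?thesis using \<phi>_symmetric[of y] by simp
  qed
  ultimately show ?thesis by linarith
qed

lemma \<phi>_triple: 
  assumes xyz: "x + y + z = r"
  shows "\<phi> x + \<phi> y + \<phi> z \<ge> 1"
proof -
  \<comment> \<open>If \<open>c\<close> is low too, \<open>F \<ge> p\<close> reduces this to the
    subadditivity and symmetry of \<open>p\<close>; if \<open>c\<close> is high,
    \<open>\<phi> c = 1 - F (a + b)\<close> and \<open>F_sub\<close> applies.\<close>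
  have two_low: "\<phi> a + \<phi> b + \<phi> c \<ge> 1"
    if "a + b + c = r" "\<phi> a = F a" "\<phi> b = F b" for a b c
  proof (cases rule: \<phi>_low_or_high[of c])
    case 1
    have "p (a + b) \<le> p a + p b" by (rule sub)
    moreover have "r - c = a + b" using that(1) by simp
    then have "p c + p (a + b) = 1" using sym[of c] by simp
    ultimately show ?thesis using that 1 F_ge[of a] F_ge[of b] F_ge[of c] by linarith
  next
    case 2
    have "r - c = a + b" using that(1) by simp
    then have "\<phi> c = 1 - F (a + b)" using 2 by simp
    then show ?thesis using that F_sub[of a b] by linarith
  qed
  \<comment> \<open>The factor 5 in the hypothesis on \<open>\<mu>\<close>:
    \<open>(s + m) / N\<close> is lost three times in passing from \<open>p\<close> to
    \<open>\<phi>\<close> and twice in the bounds near \<open>1/2\<close>.\<close>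
  have two_high: "\<phi> a + \<phi> b + \<phi> c \<ge> 1"
    if "p a \<ge> 1 / 2 - (s + m) / N" "p b \<ge> 1 / 2 - (s + m) / N" "\<mu> \<le> p c" for a b c
    using that \<phi>_ge[of a] \<phi>_ge[of b] \<phi>_ge[of c] \<mu> by linarith
  show ?thesis
  proof (cases rule: near_or_away[of z])
    case 1
    then show ?thesis using \<phi>_triple_near[OF xyz] by blast
  next
    case z: 2
    show ?thesis
    proof (cases rule: near_or_away[of y])
      case 1
      then show ?thesis using \<phi>_triple_near[of x z y] xyz by (simp add: algebra_simps)
    next
      case y: 2
      show ?thesis
      proof (cases rule: near_or_away[of x])
        case 1
        then show ?thesis using \<phi>_triple_near[of y z x] xyz by (simp add: algebra_simps)
      next
        case x: 2
        have dich: "\<phi> a = F a \<or> p a \<ge> 1 / 2 - (s + m) / N" for a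
          by (cases rule: \<phi>_low_or_high[of a]) auto
        \<comment> \<open>Pigeonhole: two of the three points are of the same kind.\<close>
        consider "\<phi> x = F x" "\<phi> y = F y" | "\<phi> x = F x" "\<phi> z = F z" | "\<phi> y = F y" "\<phi> z = F z"
          | "p x \<ge> 1 / 2 - (s + m) / N" "p y \<ge> 1 / 2 - (s + m) / N"
          | "p x \<ge> 1 / 2 - (s + m) / N" "p z \<ge> 1 / 2 - (s + m) / N"
          | "p y \<ge> 1 / 2 - (s + m) / N" "p z \<ge> 1 / 2 - (s + m) / N"
          using dich[of x] dich[of y] dich[of z] by argo
        then show ?thesis
        proof cases
          case 1
          then show ?thesis using two_low[of x y z] xyz by simp
        next
          case 2
          then show ?thesis using two_low[of x z y] xyz by simp
        next
          case 3
          then show ?thesis using two_low[of y z x] xyz by simp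
        next
          case 4
          then show ?thesis using two_high[of x y z] z by simp
        next
          case 5
          then show ?thesis using two_high[of x z y] y by simp
        next
          case 6
          then show ?thesis using two_high[of y z x] x by simp
        qed
      qed
    qed
  qed
qed

lemma \<phi>_sub: "\<phi> (x + y) \<le> \<phi> x + \<phi> y"
  using \<phi>_triple[of x y "r - (x + y)"] \<phi>_symmetric[of "x + y"] by simp

section \<open>Period, breakpoints and slopes of \<open>\<phi>\<close>\<close>

lemma \<phi>_periodic: "\<phi> (x + of_int k) = \<phi> x"
proof -
  \<comment> \<open>The integer \<open>k\<close> has fine index \<open>k * N\<close>, which must be
    even for \<open>\<phi>_shift\<close>.\<close>
  have "even N" using qN by (metis dvd_mult_left)
  then show ?thesis
    using \<phi>_shift[of "k * int N" x] p_int[of 0 k] zero N by simp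
qed

text \<open>The abscissa where the rising and the falling line of \<open>E j\<close> meet.\<close>

definition peak :: "int \<Rightarrow> real" where
  "peak j = (p ((j + 1) / N) - p (j / N) + s * (j / N) + m * ((j + 1) / N)) / (s + m)"

lemma peak_rat: "peak j \<in> \<rat>"
proof -
  have "p ((of_int j + 1) / N) \<in> \<rat>" using rat(3)[of "j + 1"] by simp
  moreover have "p (of_int j / N) \<in> \<rat>" by (rule rat(3))
  ultimately show ?thesis unfolding peak_def using rat(1,2)
    by (intro Rats_divide Rats_add Rats_diff Rats_mult) auto
qed

lemma peak_shift: "peak (j + int N * k) = peak j + of_int k"
proof -
  have e: "real_of_int (j + int N * k) / N = j / N + k"
    "(real_of_int (j + int N * k) + 1) / N = (j + 1) / N + k"
    using N by (simp_all add: field_simps)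
  have "(s + m) * peak (j + int N * k) = (s + m) * (peak j + of_int k)"
    using s m unfolding peak_def e p_int by (simp add: field_simps)
  then show ?thesis using s m by simp
qed

lemma
  fixes j :: int
  shows E_up: "x \<le> peak j \<Longrightarrow> E j x = p (j / N) + s * (x - j / N)"
    and E_down: "peak j \<le> x \<Longrightarrow> E j x = p ((j + 1) / N) + m * ((j + 1) / N - x)"
proof -
  have sm: "s + m > 0" using s m by simp
  then have P: "(s + m) * peak j = p ((j + 1) / N) - p (j / N) + s * (j / N) + m * ((j + 1) / N)"
    by (simp add: peak_def)
  {
    assume "x \<le> peak j"
    then show "E j x = p (j / N) + s * (x - j / N)"
      using mult_left_mono[of x "peak j" "s + m"] sm P by (simp add: E_def algebra_simps)
  next
    assume "peak j \<le> x"
    then show "E j x = p ((j + 1) / N) + m * ((j + 1) / N - x)"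
      using mult_left_mono[of "peak j" x "s + m"] sm P by (simp add: E_def algebra_simps)
  }
qed

text \<open>\<open>M0\<close> clears the denominators of the peaks in one period; the others differ
  from these by integers. So the grid \<open>1 / M\<close> contains all peaks and refines
  \<open>1 / N\<close>, and no cell of it meets a breakpoint in its interior. High cells reflect to
  cells of the same grid with the slope unchanged.\<close>

lemma \<phi>_two_slopes:
  obtains M :: nat where "M > 0" "N dvd M"
    "\<And>i::int. \<exists>\<sigma>\<in>{s, - m}. \<forall>x\<in>{i / M..(i + 1) / M}. \<forall>y\<in>{i / M..(i + 1) / M}. \<phi> y - \<phi> x = \<sigma> * (y - x)"
proof -
  obtain M0 :: nat where M0: "M0 > 0" "\<And>a. a \<in> peak ` {0..<int N} \<Longrightarrow> a * real M0 \<in> \<int>"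
    using common_denominator[of "peak ` {0..<int N}"] peak_rat by auto
  define M where "M = M0 * N"
  have M: "M > 0" "N dvd M" using M0 N by (auto simp: M_def)
  have peakM: "peak j * M \<in> \<int>" for j
  proof -
    have "peak j = peak (j mod int N) + of_int (j div int N)"
      using peak_shift[of "j mod int N" "j div int N"] by simp
    moreover have "peak (j mod int N) * M0 \<in> \<int>" using M0(2) N by simp
    then have "peak (j mod int N) * M0 * N \<in> \<int>" by (rule Ints_mult) simp
    then have "peak (j mod int N) * M0 * N + of_int (j div int N * int M0 * int N) \<in> \<int>"
      by (rule Ints_add) (rule Ints_of_int)
    ultimately show ?thesis by (simp add: M_def algebra_simps)
  qed
  have inside: "\<exists>j::int. j / N \<le> i / M \<and> (i + 1) / M \<le> (j + 1) / N" for i :: int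
  proof -
    define j where "j = i div int M0"
    have "i = j * int M0 + i mod int M0" "0 \<le> i mod int M0" "i mod int M0 < int M0"
      using M0(1) by (simp_all add: j_def)
    then have "j * int M0 \<le> i" "i + 1 \<le> (j + 1) * int M0"
      unfolding distrib_right by linarith+
    moreover have "real_of_int u / N = of_int (u * int M0) / M" for u
      using M0(1) by (simp add: M_def)
    ultimately show ?thesis
      by (intro exI[of _ j]) (simp only: divide_right_mono of_int_le_iff of_nat_0_le_iff simp_thms)
  qed
  have F_slope: "\<exists>\<sigma>\<in>{s, - m}. \<forall>x\<in>{i / M..(i + 1) / M}. \<forall>y\<in>{i / M..(i + 1) / M}. F y - F x = \<sigma> * (y - x)" for i :: int
  proof -
    obtain j :: int where j: "j / N \<le> i / M" "(i + 1) / M \<le> (j + 1) / N" using inside by blast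
    have FE: "F x = E j x" if "x \<in> {i / M..(i + 1) / M}" for x
      using that j by (intro F_cell) auto
    obtain P :: int where P: "peak j * M = P" using peakM[of j] by (auto elim: Ints_cases)
    then have P': "peak j = P / M" using M by (simp add: field_simps)
    show ?thesis
    proof (cases "i + 1 \<le> P")
      case True
      then have "real_of_int (i + 1) / M \<le> peak j" unfolding P' by (intro divide_right_mono) simp_all
      then have Fx: "F x = p (j / N) + s * (x - j / N)" if "x \<in> {i / M..(i + 1) / M}" for x
        using FE[OF that] E_up[of x j] that by simp
      show ?thesis by (intro bexI[of _ s] ballI, unfold Fx) (simp_all add: algebra_simps)
    next
      case False
      then have "peak j \<le> i / M" unfolding P' by (intro divide_right_mono) simp_all
      then have Fx: "F x = p ((j + 1) / N) + m * ((j + 1) / N - x)" if "x \<in> {i / M..(i + 1) / M}" for x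
        using FE[OF that] E_down[of j x] that by simp
      show ?thesis by (intro bexI[of _ "- m"] ballI, unfold Fx) (simp_all add: algebra_simps)
    qed
  qed
  have "\<exists>\<sigma>\<in>{s, - m}. \<forall>x\<in>{i / M..(i + 1) / M}. \<forall>y\<in>{i / M..(i + 1) / M}. \<phi> y - \<phi> x = \<sigma> * (y - x)" for i :: int
  proof -
    obtain j :: int where j: "j / N \<le> i / M" "(i + 1) / M \<le> (j + 1) / N" using inside by blast
    have \<phi>c: "\<phi> x = (if low j then F x else 1 - F (r - x))" if "x \<in> {i / M..(i + 1) / M}" for x
      using that j by (intro \<phi>_cell) auto
    show ?thesis
    proof (cases "low j")
      case True
      then show ?thesis using F_slope[of i] \<phi>c by simp
    next
      case False
      \<comment> \<open>The index of the reflected cell; the \<open>- 1\<close> arises because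
        reflection exchanges the ends of a cell.\<close>
      define i' where "i' = R * int M0 - 1 - i"
      have rM: "r = real_of_int R * M0 / M" using R N M0 by (simp add: M_def field_simps)
      have "i' / M = r - (i + 1) / M" "(i' + 1) / M = r - i / M"
        unfolding rM i'_def by (simp_all add: add_divide_distrib diff_divide_distrib)
      then have refl: "r - x \<in> {i' / M..(i' + 1) / M}" if "x \<in> {i / M..(i + 1) / M}" for x
        using that by auto
      obtain \<sigma> where \<sigma>: "\<sigma> \<in> {s, - m}"
        "\<forall>x\<in>{i' / M..(i' + 1) / M}. \<forall>y\<in>{i' / M..(i' + 1) / M}. F y - F x = \<sigma> * (y - x)"
        using F_slope by blast
      show ?thesis
      proof (intro bexI[OF _ \<sigma>(1)] ballI)
        fix x y assume x: "x \<in> {i / M..(i + 1) / M}" and y: "y \<in> {i / M..(i + 1) / M}"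
        have "F (r - x) - F (r - y) = \<sigma> * ((r - x) - (r - y))"
          using \<sigma>(2) refl[OF x] refl[OF y] by blast
        then show "\<phi> y - \<phi> x = \<sigma> * (y - x)" using \<phi>c[OF x] \<phi>c[OF y] False by simp
      qed
    qed
  qed
  then show ?thesis using that M by blast
qed

section \<open>Passage from the reals to the circle\<close>

lemma circle_approximation:
  assumes "f \<noteq> 0" "circle_of r = f" "\<And>x. p x = \<pi> (circle_of x)"
  shows "\<exists>\<Phi>. extreme f \<Phi> \<and> continuous_on UNIV \<Phi> \<and>
    (\<exists>C. piecewise_linear_on C \<Phi> \<and> C \<subseteq> rational_points) \<and>
    (\<forall>c. \<bar>\<Phi> c - \<pi> c\<bar> \<le> (s + m) / N) \<and>
    (\<forall>k::int. \<Phi> (circle_of (k / N)) = \<pi> (circle_of (k / N)))"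
proof -
  define \<Phi> where "\<Phi> c = \<phi> (rep_circle c)" for c
  have \<Phi>: "\<Phi> (circle_of x) = \<phi> x" for x
  proof -
    have "rep_circle (circle_of x) - x \<in> \<int>"
      by (simp add: circle_of_eq_iff[symmetric] circle_of_rep)
    then obtain k :: int where "rep_circle (circle_of x) - x = k" by (auto elim: Ints_cases)
    then have "rep_circle (circle_of x) = x + k" by simp
    then show ?thesis by (simp add: \<Phi>_def \<phi>_periodic)
  qed
  have ball: "(\<forall>c. P c) \<longleftrightarrow> (\<forall>x. P (circle_of x))" for P
    by (metis circle_of_rep)
  obtain M :: nat where M: "M > 0" "N dvd M" and slopes:
    "\<And>i::int. \<exists>\<sigma>\<in>{s, - m}. \<forall>x\<in>{i / M..(i + 1) / M}. \<forall>y\<in>{i / M..(i + 1) / M}. \<phi> y - \<phi> x = \<sigma> * (y - x)"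
    using \<phi>_two_slopes by blast
  have "q dvd M" using qN M(2) by (metis dvd_mult_right dvd_trans)
  then have "q \<le> M" using M by (simp add: dvd_imp_le)
  then have qM: "1 / real M \<le> 1 / q" using q by (simp add: frac_le)
  have "minimal_valid f \<Phi>"
    unfolding minimal_valid_iff[OF assms(1)] ball
    using \<phi>_nonneg \<phi>_sub \<phi>_symmetric \<phi>_grid[of 0] zero \<Phi>[of 0]
    by (simp add: circle_of_0 assms(2)[symmetric] circle_of_add[symmetric] circle_of_minus[symmetric] \<Phi>)
  then have "extreme f \<Phi>"
  proof (rule two_slope_extreme[OF assms(1) _ M(1) s m])
    show "\<Phi> (circle_of t) = s * t" if "0 \<le> t" "t \<le> 1 / M" for t
      using \<phi>_near0[of t] g_pos[of t] that qM by (simp add: \<Phi>)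
    show "\<Phi> (circle_of (- t)) = m * t" if "0 \<le> t" "t \<le> 1 / M" for t
      using \<phi>_near0[of "- t"] g_neg[of "- t"] that qM by (simp add: \<Phi>)
  qed (use slopes \<Phi> in simp)
  moreover have "continuous_on UNIV \<Phi>"
  proof -
    have "(s + m)-lipschitz_on UNIV \<phi>"
    proof (rule lipschitz_onI)
      fix x y
      show "dist (\<phi> x) (\<phi> y) \<le> (s + m) * dist x y"
        using \<phi>_lip[of x y] \<phi>_lip[of y x] g_le[of "x - y"] g_le[of "y - x"]
        by (auto simp: dist_real_def abs_minus_commute abs_le_iff)
    qed (use s m in simp)
    then show ?thesis
      unfolding continuous_on_circle_iff \<Phi> by (rule lipschitz_on_continuous_on)
  qed
  moreover have "\<exists>C. piecewise_linear_on C \<Phi> \<and> C \<subseteq> rational_points"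
  proof (intro exI conjI)
    define C where "C = (\<lambda>i::int. circle_of (i / M)) ` {0..<int M}"
    have inC: "circle_of (of_int i / M) \<in> C" for i
    proof -
      have "real_of_int i = real_of_int (i mod int M) + M * real_of_int (i div int M)"
        by (metis mod_mult_div_eq of_int_add of_int_mult of_int_of_nat_eq)
      then have "real_of_int i / M - real_of_int (i mod int M) / M = of_int (i div int M)"
        using M by (simp add: field_simps)
      then have "circle_of (of_int i / M) = circle_of (of_int (i mod int M) / M)"
        unfolding circle_of_eq_iff by simp
      then show ?thesis using M by (auto simp: C_def)
    qed
    show "piecewise_linear_on C \<Phi>"
      unfolding piecewise_linear_on_def
    proof (intro conjI allI impI)
      show "finite C" by (simp add: C_def)
      show "C \<noteq> {}" using M by (simp add: C_def)
      fix a b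
      assume ab: "a < b \<and> circle_of a \<in> C \<and> circle_of b \<in> C \<and> (\<forall>x\<in>{a<..<b}. circle_of x \<notin> C)"
      define i where "i = \<lfloor>a * M\<rfloor>"
      have i: "i / M \<le> a" "a < (i + 1) / M" using floor_cell[OF M(1), of a] by (auto simp: i_def)
      \<comment> \<open>Otherwise \<open>(i + 1) / M\<close> would be a point of \<open>C\<close>
        strictly between \<open>a\<close> and \<open>b\<close>.\<close>
      have "b \<le> (i + 1) / M"
        using inC[of "i + 1"] ab i by (metis greaterThanLessThan_iff not_less)
      then have sub: "{a<..<b} \<subseteq> {i / M..(i + 1) / M}" using i by auto
      obtain \<sigma> where \<sigma>: "\<And>x y. x \<in> {i / M..(i + 1) / M} \<Longrightarrow> y \<in> {i / M..(i + 1) / M} \<Longrightarrow> \<phi> y - \<phi> x = \<sigma> * (y - x)"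
        using slopes[of i] by blast
      have "i / M \<in> {i / M..(i + 1) / M}" using i by simp
      then have "\<phi> x = \<sigma> * x + (\<phi> (i / M) - \<sigma> * (i / M))" if "x \<in> {a<..<b}" for x
        using \<sigma>[of "i / M" x] sub that by (auto simp: algebra_simps)
      then show "\<exists>\<sigma> c. \<forall>x\<in>{a<..<b}. \<Phi> (circle_of x) = \<sigma> * x + c" unfolding \<Phi> by blast
    qed
    show "C \<subseteq> rational_points" by (auto simp: C_def rational_points_def)
  qed
  moreover have "\<bar>\<Phi> c - \<pi> c\<bar> \<le> (s + m) / N" for c
  proof -
    obtain x where x: "c = circle_of x" by (metis circle_of_rep)
    then show ?thesis using \<phi>_ge[of x] \<phi>_le[of x] by (simp add: \<Phi> assms(3)[symmetric] abs_le_iff)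
  qed
  moreover have "\<Phi> (circle_of (of_int k / N)) = \<pi> (circle_of (of_int k / N))" for k
    using \<phi>_grid[of k] by (simp add: \<Phi> assms(3))
  ultimately show ?thesis by blast
qed

end

section \<open>Piecewise linear functions with rational data\<close>

lemma circle_common_denominator:
  assumes "finite B" "B \<subseteq> rational_points"
  obtains q :: nat where "q > 0" "\<And>x::real. circle_of x \<in> B \<Longrightarrow> x * q \<in> \<int>"
proof -
  have rat: "x \<in> \<rat>" if x: "circle_of x \<in> B" for x
  proof -
    obtain y where y: "y \<in> \<rat>" "circle_of x = circle_of y"
      using assms(2) x by (auto simp: rational_points_def)
    then have "x - y \<in> \<rat>" by (metis circle_of_eq_iff Ints_subset_Rats subsetD)
    then show ?thesis using y(1) Rats_add[of "x - y" y] by simp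
  qed
  have "rep_circle ` B \<subseteq> \<rat>" using rat by (auto simp: circle_of_rep)
  then obtain q :: nat where q: "q > 0" "\<And>a. a \<in> rep_circle ` B \<Longrightarrow> a * q \<in> \<int>"
    using common_denominator assms(1) by (metis finite_imageI)
  have "x * q \<in> \<int>" if x: "circle_of x \<in> B" for x :: real
  proof -
    have "x - rep_circle (circle_of x) \<in> \<int>"
      unfolding circle_of_eq_iff[symmetric] by (simp add: circle_of_rep)
    then have "(x - rep_circle (circle_of x)) * q + rep_circle (circle_of x) * q \<in> \<int>"
      using q(2) x by (intro Ints_add) (auto intro: Ints_mult)
    then show ?thesis by (simp add: algebra_simps)
  qed
  then show ?thesis using q that by blast
qed

lemma eq_on_closed_interval:
  fixes h k :: "real \<Rightarrow> real"
  assumes "continuous_on UNIV h" "continuous_on UNIV k" "a < b" "\<And>x. x \<in> {a<..<b} \<Longrightarrow> h x = k x"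
    and "x \<in> {a..b}"
  shows "h x = k x"
proof -
  have "closure {a<..<b} \<subseteq> {x. h x = k x}"
    using assms by (intro closure_minimal closed_Collect_eq) auto
  then show ?thesis using assms by auto
qed

text \<open>The cell lies between two consecutive breakpoints \<open>a\<close> and \<open>b\<close>.
  Slope and intercept are rational because they are determined by the rational values at rational
  \<open>a\<close> and \<open>b\<close>.\<close>

lemma piecewise_linear_on_cell:
  fixes q :: nat and i :: int
  assumes cont: "continuous_on UNIV \<pi>" and pwl: "piecewise_linear_on B \<pi>" and q: "q > 0"
    and grid: "\<And>x::real. circle_of x \<in> B \<Longrightarrow> x * q \<in> \<int>" and rat: "\<forall>b\<in>B. \<pi> b \<in> \<rat>"
  obtains m c where "m \<in> \<rat>" "c \<in> \<rat>" "\<And>x. x \<in> {i / q..(i + 1) / q} \<Longrightarrow> \<pi> (circle_of x) = m * x + c"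
proof -
  define J where "J = {j::int. circle_of (j / q) \<in> B}"
  obtain b0 where b0: "circle_of b0 \<in> B"
    using pwl unfolding piecewise_linear_on_def by (metis circle_of_rep ex_in_conv)
  obtain k0 :: int where "b0 * q = k0" using grid[OF b0] by (auto elim: Ints_cases)
  then have "b0 = k0 / q" using q by (simp add: field_simps)
  then have k0: "k0 \<in> J" using b0 by (simp add: J_def)
  have J_shift: "j + int q * n \<in> J" if "j \<in> J" for j n
  proof -
    have "circle_of ((j + int q * n) / q) = circle_of (j / q)"
      using q by (simp add: circle_of_eq_iff add_divide_distrib)
    then show ?thesis using that by (simp add: J_def)
  qed
  \<comment> \<open>Shifting one breakpoint by enough periods puts breakpoints on both sides of the
    cell, so the \<open>Max\<close> and \<open>Min\<close> below range over nonempty finite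
    sets.\<close>
  define jl where "jl = k0 + int q * - \<bar>k0 - i\<bar>"
  define jr where "jr = k0 + int q * (\<bar>k0 - i\<bar> + 1)"
  have jJ: "jl \<in> J" "jr \<in> J" unfolding jl_def jr_def using J_shift k0 by blast+
  have "1 * \<bar>k0 - i\<bar> \<le> int q * \<bar>k0 - i\<bar>" using q by (intro mult_right_mono) auto
  then have jl: "jl \<le> i" by (simp add: jl_def)
  have "1 * (\<bar>k0 - i\<bar> + 1) \<le> int q * (\<bar>k0 - i\<bar> + 1)" using q by (intro mult_right_mono) auto
  moreover have "i + 1 \<le> k0 + 1 * (\<bar>k0 - i\<bar> + 1)" by arith
  ultimately have jr: "i + 1 \<le> jr" unfolding jr_def by linarith
  define ja where "ja = Max (J \<inter> {jl..i})"
  define jb where "jb = Min (J \<inter> {i + 1..jr})"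
  have "ja \<in> J \<inter> {jl..i}" unfolding ja_def using jJ jl by (intro Max_in) auto
  then have ja: "ja \<in> J" "ja \<le> i" by auto
  have "jb \<in> J \<inter> {i + 1..jr}" unfolding jb_def using jJ jr by (intro Min_in) auto
  then have jb: "jb \<in> J" "i + 1 \<le> jb" by auto
  have gap: "j \<notin> J" if "ja < j" "j < jb" for j
  proof
    assume j: "j \<in> J"
    show False
    proof (cases "j \<le> i")
      case True
      show ?thesis
      proof (cases "jl \<le> j")
        case True
        then have "j \<le> ja" unfolding ja_def using j \<open>j \<le> i\<close> by (intro Max_ge) auto
        then show ?thesis using that by simp
      next
        case False
        then show ?thesis using that \<open>ja \<in> J \<inter> {jl..i}\<close> by auto
      qed
    next
      case False
      show ?thesis
      proof (cases "j \<le> jr")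
        case True
        then have "jb \<le> j" unfolding jb_def using j False by (intro Min_le) auto
        then show ?thesis using that by simp
      next
        case False
        then show ?thesis using that \<open>jb \<in> J \<inter> {i + 1..jr}\<close> by auto
      qed
    qed
  qed
  define a where "a = ja / q"
  define b where "b = jb / q"
  have ab: "a < b" using ja jb q by (simp add: a_def b_def divide_strict_right_mono)
  have aB: "circle_of a \<in> B" and bB: "circle_of b \<in> B" using ja jb by (auto simp: J_def a_def b_def)
  have "circle_of x \<notin> B" if x: "x \<in> {a<..<b}" for x
  proof
    assume xB: "circle_of x \<in> B"
    obtain k :: int where "x * q = k" using grid[OF xB] by (auto elim: Ints_cases)
    then have k: "x = k / q" using q by (simp add: field_simps)
    then have "ja < k" "k < jb" using x q by (auto simp: a_def b_def divide_less_cancel)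
    then show False using gap xB k by (simp add: J_def)
  qed
  then obtain m c where lin: "\<And>x. x \<in> {a<..<b} \<Longrightarrow> \<pi> (circle_of x) = m * x + c"
    using pwl ab aB bB unfolding piecewise_linear_on_def by meson
  \<comment> \<open>Linearity is given on the open interval only; continuity carries it to the
    breakpoints, where the values are known.\<close>
  have lin': "\<pi> (circle_of x) = m * x + c" if "x \<in> {a..b}" for x
    using cont unfolding continuous_on_circle_iff
    by (rule eq_on_closed_interval[OF _ _ ab lin that]) (auto intro!: continuous_intros)
  have "m = (\<pi> (circle_of b) - \<pi> (circle_of a)) / (b - a)"
    using lin'[of a] lin'[of b] ab by (simp add: field_simps)
  then have mQ: "m \<in> \<rat>" using rat aB bB by (auto simp: a_def b_def)
  moreover have "c = \<pi> (circle_of a) - m * a" using lin'[of a] ab by simp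
  then have "c \<in> \<rat>" using rat aB mQ by (auto simp: a_def)
  moreover have "{i / q..(i + 1) / q} \<subseteq> {a..b}"
    using ja jb q by (auto simp: a_def b_def intro: order_trans divide_right_mono)
  ultimately show ?thesis using that lin' by blast
qed

text \<open>Any \<open>x > 0\<close> is a multiple of some \<open>x / n \<le> d\<close>. Applied to
  \<open>p\<close> and its mirror image, this shows that neither one-sided slope at 0 vanishes, as
  \<open>p r = 1\<close>.\<close>

lemma subadditive_not_zero_near_0:
  fixes p :: "real \<Rightarrow> real"
  assumes nonneg: "\<And>x. p x \<ge> 0" and sub: "\<And>x y. p (x + y) \<le> p x + p y"
    and "d > 0" and z: "\<And>t. 0 \<le> t \<Longrightarrow> t \<le> d \<Longrightarrow> p t = 0"
    and "0 < x"
  shows "p x = 0"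
proof -
  obtain n :: nat where n: "x / d < n" using reals_Archimedean2 by blast
  have n0: "n > 0" using n \<open>0 < x\<close> \<open>d > 0\<close> by (metis divide_pos_pos less_trans of_nat_0_less_iff)
  have 0: "p (x / n) = 0" using n n0 \<open>0 < x\<close> \<open>d > 0\<close> by (intro z) (auto simp: field_simps)
  have "p (real k * (x / n)) = 0" for k
  proof (induction k)
    case (Suc k)
    have "real (Suc k) * (x / n) = x / n + real k * (x / n)"
      by (simp only: of_nat_Suc distrib_right mult_1_left)
    then have "p (real (Suc k) * (x / n)) \<le> 0"
      using sub[of "x / n" "real k * (x / n)"] Suc 0 by simp
    then show ?case using nonneg antisym by blast
  qed (simp add: z \<open>d > 0\<close> less_imp_le)
  from this[of n] show ?thesis using n0 by simp
qed

theorem corollary1p9: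
  fixes f :: circle and \<pi> :: "circle \<Rightarrow> real" and B :: "circle set"
  assumes "f \<noteq> 0"
    and "minimal_valid f \<pi>"
    and "\<not> extreme f \<pi>"
    and "continuous_on UNIV \<pi>"
    and "piecewise_linear_on B \<pi>"
    and "B \<subseteq> rational_points"
    and "\<forall>p\<in>B. \<pi> p \<in> \<rat>"
  shows "\<exists>\<phi> :: nat \<Rightarrow> circle \<Rightarrow> real.
           (\<forall>i. extreme f (\<phi> i) \<and> continuous_on UNIV (\<phi> i) \<and>
                (\<exists>C. piecewise_linear_on C (\<phi> i) \<and> C \<subseteq> rational_points)) \<and>
           uniform_limit UNIV \<phi> \<pi> sequentially \<and>
           (\<forall>x\<in>rational_points. \<exists>c. \<forall>\<^sub>F i in sequentially. \<phi> i x = c)"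
proof -
  note mv = assms(2)[unfolded minimal_valid_iff[OF assms(1)]]
  define p where "p x = \<pi> (circle_of x)" for x
  define r where "r = rep_circle f"
  have r: "circle_of r = f" by (simp add: r_def circle_of_rep)
  have nonneg: "p x \<ge> 0" and zero: "p 0 = 0" and sub: "p (x + y) \<le> p x + p y"
    and sym: "p x + p (r - x) = 1" for x y
    using mv by (auto simp: p_def circle_of_add circle_of_minus circle_of_0 r)
  have per: "p (x + of_int k) = p x" for x k
    by (simp add: p_def circle_of_add circle_of_int)
  have pr: "p r = 1" using sym[of 0] zero by simp
  have le1: "p x \<le> 1" for x using sym[of x] nonneg[of "r - x"] by linarith
  have no_right: "\<not> (\<forall>t. 0 \<le> t \<longrightarrow> t \<le> d \<longrightarrow> p t = 0)" if d: "d > 0" for d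
  proof
    assume 0: "\<forall>t. 0 \<le> t \<longrightarrow> t \<le> d \<longrightarrow> p t = 0"
    \<comment> \<open>The integer shift makes the argument positive.\<close>
    have "p (r + of_int (\<lceil>\<bar>r\<bar>\<rceil> + 1)) = 0"
      by (rule subadditive_not_zero_near_0[OF nonneg sub d]) (use 0 in auto, linarith)
    then show False using per[of r "\<lceil>\<bar>r\<bar>\<rceil> + 1"] pr by simp
  qed
  have no_left: "\<not> (\<forall>t. 0 \<le> t \<longrightarrow> t \<le> d \<longrightarrow> p (- t) = 0)" if d: "d > 0" for d
  proof
    assume 0: "\<forall>t. 0 \<le> t \<longrightarrow> t \<le> d \<longrightarrow> p (- t) = 0"
    have sub': "p (- (x + y)) \<le> p (- x) + p (- y)" for x y using sub[of "- x" "- y"] by simp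
    have "p (- (of_int (\<lceil>\<bar>r\<bar>\<rceil> + 1) - r)) = 0"
      by (rule subadditive_not_zero_near_0[where p = "\<lambda>x. p (- x)", OF nonneg sub' d])
        (use 0 in auto, linarith)
    then show False using per[of r "- (\<lceil>\<bar>r\<bar>\<rceil> + 1)"] pr by (simp add: algebra_simps)
  qed
  have "finite B" using assms(5) by (simp add: piecewise_linear_on_def)
  then obtain q0 :: nat where q0: "q0 > 0" "\<And>x::real. circle_of x \<in> B \<Longrightarrow> x * q0 \<in> \<int>"
    using circle_common_denominator assms(6) by metis
  have "isCont p 0"
    using assms(4) unfolding continuous_on_circle_iff p_def[symmetric] continuous_on_eq_continuous_at[OF open_UNIV]
    by simp
  then obtain \<delta> where \<delta>0: "\<delta> > 0" "\<And>x. dist x 0 < \<delta> \<Longrightarrow> dist (p x) (p 0) < 1 / 2"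
    unfolding continuous_at_eps_delta by (meson half_gt_zero zero_less_one)
  have \<delta>: "\<delta> > 0" "\<And>x. \<bar>x\<bar> < \<delta> \<Longrightarrow> p x < 1 / 2"
    using \<delta>0 zero nonneg by (auto simp: dist_real_def)
  obtain k :: nat where k: "1 / \<delta> < k" using reals_Archimedean2 by blast
  then have k0: "k > 0" using \<delta>(1) by (metis divide_pos_pos less_trans of_nat_0_less_iff zero_less_one)
  \<comment> \<open>\<open>q0\<close> puts all breakpoints on the grid; the factor \<open>k\<close>
    makes \<open>1 / q < \<delta>\<close>, which gives \<open>low0\<close>.\<close>
  define q where "q = q0 * k"
  have q: "q > 0" using q0 k0 by (simp add: q_def)
  have "k \<le> q" using q0(1) by (simp add: q_def)
  then have "1 / \<delta> < q" using k by linarith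
  then have q\<delta>: "1 / q < \<delta>" using q \<delta>(1) by (simp add: field_simps)
  have grid: "x * q \<in> \<int>" if "circle_of x \<in> B" for x :: real
    using Ints_mult[OF q0(2)[OF that] Ints_of_nat[of k]] by (simp add: q_def mult.assoc)
  have cell: "\<exists>a c. a \<in> \<rat> \<and> c \<in> \<rat> \<and> (\<forall>x\<in>{i / q..(i + 1) / q}. p x = a * x + c)" for i :: int
    using piecewise_linear_on_cell[OF assms(4,5) q grid assms(7), of i] unfolding p_def by metis
  \<comment> \<open>\<open>p\<close> has its maximum 1 at \<open>r\<close>. Inside a cell this would
    force \<open>p\<close> to be constant near \<open>r\<close> and hence, by symmetry, zero near
    0.\<close>
  have rq: "r * q \<in> \<int>"
  proof (rule ccontr)
    assume r_no: "r * q \<notin> \<int>"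
    define i where "i = \<lfloor>r * q\<rfloor>"
    have i: "i / q \<le> r" "r < (i + 1) / q" using floor_cell[OF q, of r] by (auto simp: i_def)
    have "i / q \<noteq> r" using r_no q by auto
    then have i': "i / q < r" using i by simp
    define h where "h = min (r - i / q) ((i + 1) / q - r)"
    have h: "h > 0" using i i' by (simp add: h_def)
    have inside: "r + t \<in> {i / q..(i + 1) / q}" if "\<bar>t\<bar> \<le> h" for t
      using that by (auto simp: h_def abs_le_iff)
    obtain a c where ac: "\<And>x. x \<in> {i / q..(i + 1) / q} \<Longrightarrow> p x = a * x + c"
      using cell[of i] by blast
    have lin: "p (r + t) = 1 + a * t" if "\<bar>t\<bar> \<le> h" for t
      using ac[OF inside[OF that]] ac[OF inside[of 0]] pr h by (simp add: algebra_simps)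
    have "a * h \<le> 0" "0 \<le> a * h" using lin[of h] lin[of "- h"] le1[of "r + h"] le1[of "r + - h"] h by auto
    then have "a = 0" using h by (simp add: mult_le_0_iff zero_le_mult_iff)
    then have "p t = 0" if "0 \<le> t" "t \<le> h" for t
      using lin[of "- t"] sym[of "r + - t"] that by simp
    then show False using no_right[OF h] by blast
  qed
  define s where "s = p (1 / q) * q"
  define m where "m = p (- (1 / q)) * q"
  obtain a1 c1 where ac1: "a1 \<in> \<rat>" "\<And>x. x \<in> {0..1 / q} \<Longrightarrow> p x = a1 * x + c1"
    using cell[of 0] by auto
  obtain a2 c2 where ac2: "a2 \<in> \<rat>" "\<And>x. x \<in> {- (1 / q)..0} \<Longrightarrow> p x = a2 * x + c2"
    using cell[of "- 1"] by auto
  have c0: "c1 = 0" "c2 = 0" using ac1(2)[of 0] ac2(2)[of 0] zero by auto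
  have sa: "s = a1" "m = - a2"
    using ac1(2)[of "1 / q"] ac2(2)[of "- (1 / q)"] c0 q by (auto simp: s_def m_def)
  have right: "p t = s * t" if "0 \<le> t" "t \<le> 1 / q" for t
    using ac1(2)[of t] that c0 sa by simp
  have left: "p (- t) = m * t" if "0 \<le> t" "t \<le> 1 / q" for t
    using ac2(2)[of "- t"] that c0 sa by simp
  have "s \<noteq> 0" using no_right[of "1 / q"] right q by auto
  moreover have "s \<ge> 0" unfolding s_def by (intro mult_nonneg_nonneg nonneg) simp
  ultimately have s: "s > 0" by linarith
  have "m \<noteq> 0" using no_left[of "1 / q"] left q by auto
  moreover have "m \<ge> 0" unfolding m_def by (intro mult_nonneg_nonneg nonneg) simp
  ultimately have m: "m > 0" by linarith
  have low0: "s / q < 1 / 2" "m / q < 1 / 2"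
    using \<delta>(2)[of "1 / q"] \<delta>(2)[of "- (1 / q)"] q\<delta> q by (auto simp: s_def m_def)
  \<comment> \<open>By periodicity the grid values in one period suffice. Inserting 1 makes the set
    nonempty and \<open>\<mu> \<le> 1\<close>.\<close>
  define V where "V = {v \<in> (\<lambda>i::int. p (i / q)) ` {0..<int q}. v \<noteq> 0}"
  define \<mu> where "\<mu> = Min (insert 1 V)"
  have finV: "finite V" by (simp add: V_def)
  have \<mu>1: "\<mu> \<le> 1" using finV by (simp add: \<mu>_def)
  have "v > 0" if "v \<in> V" for v
  proof -
    have "v \<ge> 0" "v \<noteq> 0" using that nonneg by (auto simp: V_def)
    then show ?thesis by linarith
  qed
  then have \<mu>0: "\<mu> > 0" using finV by (simp add: \<mu>_def)
  have \<mu>_grid: "\<mu> \<le> p (of_int i / q)" if "p (of_int i / q) \<noteq> 0" for i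
  proof -
    have "real_of_int i = real_of_int (i mod int q) + q * real_of_int (i div int q)"
      by (metis mod_mult_div_eq of_int_add of_int_mult of_int_of_nat_eq)
    then have "real_of_int i / q = of_int (i mod int q) / q + of_int (i div int q)"
      using q by (simp add: field_simps)
    then have "p (of_int i / q) = p (of_int (i mod int q) / q)" using per by simp
    then have "p (of_int i / q) \<in> V" using that q by (auto simp: V_def)
    then show ?thesis using finV by (simp add: \<mu>_def)
  qed
  have away: "\<mu> \<le> p x"
    if i: "p (of_int i / q) \<noteq> 0" "p (of_int (i + 1) / q) \<noteq> 0" "of_int i / q \<le> x" "x \<le> of_int (i + 1) / q"
    for i x
  proof -
    obtain a c where ac: "\<And>x. x \<in> {i / q..(i + 1) / q} \<Longrightarrow> p x = a * x + c"
      using cell[of i] by blast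
    have "p x = a * x + c" "p (i / q) = a * (i / q) + c" "p ((i + 1) / q) = a * ((i + 1) / q) + c"
      using i(3,4) by (simp_all only: ac atLeastAtMost_iff order_refl order_trans[OF i(3,4)] simp_thms)
    \<comment> \<open>An affine function on a cell is bounded below by its value at one of the
      ends.\<close>
    moreover have "a * (i / q) \<le> a * x \<or> a * ((i + 1) / q) \<le> a * x"
      using mult_left_mono[OF i(3), of a] mult_left_mono_neg[OF i(4), of a] by linarith
    ultimately show ?thesis using \<mu>_grid[OF i(1)] \<mu>_grid[OF i(2)] by linarith
  qed
  obtain n0 :: nat where n0: "5 * (s + m) / \<mu> < n0" using reals_Archimedean2 by blast
  have "5 * (s + m) / \<mu> > 0" using s m \<mu>0 by simp
  then have "n0 > 0" using n0 by (metis less_trans of_nat_0_less_iff)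
  \<comment> \<open>\<open>2 * q\<close> gives the divisibility and parity conditions,
    \<open>n0\<close> exceeds \<open>5 * (s + m) / \<mu>\<close>, and \<open>fact n\<close> absorbs
    every denominator up to \<open>n\<close>.\<close>
  define N where "N n = 2 * q * n0 * fact n" for n
  have N: "N n > 0" for n using q \<open>n0 > 0\<close> by (simp add: N_def)
  have N_ge: "real n0 * n \<le> N n" "n0 \<le> N n" for n
  proof -
    have "n \<le> fact n" by (rule fact_ge_self)
    moreover have "1 \<le> 2 * q" using q by simp
    ultimately have "1 * (n0 * n) \<le> (2 * q) * (n0 * fact n)" "1 * (n0 * 1) \<le> (2 * q) * (n0 * fact n)"
      using fact_ge_1[of n, where 'a = nat] by (intro mult_le_mono; simp)+
    then have "n0 * n \<le> N n" "n0 \<le> N n" by (simp_all add: N_def algebra_simps)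
    then show "real n0 * n \<le> N n" "n0 \<le> N n" by (metis of_nat_mult of_nat_le_iff)+
  qed
  have "\<exists>\<Phi>. extreme f \<Phi> \<and> continuous_on UNIV \<Phi> \<and>
    (\<exists>C. piecewise_linear_on C \<Phi> \<and> C \<subseteq> rational_points) \<and>
    (\<forall>c. \<bar>\<Phi> c - \<pi> c\<bar> \<le> (s + m) / N n) \<and>
    (\<forall>k::int. \<Phi> (circle_of (k / N n)) = \<pi> (circle_of (k / N n)))" for n
  proof -
    obtain \<rho> :: int where \<rho>: "r * q = \<rho>" using rq by (auto elim: Ints_cases)
    interpret fill_in p r s m \<mu> q "N n" "2 * (\<rho> * int n0 * fact n)"
    proof
      show "p (x + 1) = p x" for x using per[of x 1] by simp
      show "2 * q dvd N n" by (simp add: N_def mult.assoc)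
      show "r * N n = of_int (2 * (\<rho> * int n0 * fact n))"
        by (simp add: N_def \<rho>[symmetric] algebra_simps)
      have "5 * (s + m) < \<mu> * n0" using n0 \<mu>0 by (simp add: field_simps)
      also have "\<dots> \<le> \<mu> * N n" using N_ge(2)[of n] \<mu>0 by simp
      finally show "5 * ((s + m) / N n) \<le> \<mu>" using N[of n] by (simp add: field_simps)
      show "s \<in> \<rat>" "m \<in> \<rat>" using sa ac1 ac2 by auto
      fix i :: int
      define x where "x = i / N n"
      obtain a c where ac: "a \<in> \<rat>" "c \<in> \<rat>"
        "\<And>y. y \<in> {\<lfloor>x * q\<rfloor> / q..(\<lfloor>x * q\<rfloor> + 1) / q} \<Longrightarrow> p y = a * y + c"
        using cell by metis
      have "p x = a * x + c" using floor_cell[OF q, of x] by (intro ac(3)) auto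
      then show "p (i / N n) \<in> \<rat>" using ac(1,2) by (simp add: x_def)
    qed (use nonneg zero sub sym q N s m right left low0 away \<mu>1 in auto)
    show ?thesis using circle_approximation[OF assms(1) r] by (simp add: p_def)
  qed
  then obtain \<phi> where \<phi>: "\<And>n. extreme f (\<phi> n)" "\<And>n. continuous_on UNIV (\<phi> n)"
    "\<And>n. \<exists>C. piecewise_linear_on C (\<phi> n) \<and> C \<subseteq> rational_points"
    "\<And>n c. \<bar>\<phi> n c - \<pi> c\<bar> \<le> (s + m) / N n"
    "\<And>n (k::int). \<phi> n (circle_of (k / N n)) = \<pi> (circle_of (k / N n))"
    by metis
  have "uniform_limit UNIV \<phi> \<pi> sequentially"
  proof (rule uniform_limitI)
    fix e :: real assume e: "e > 0"
    obtain n1 :: nat where n1: "(s + m) / e < n1" using reals_Archimedean2 by blast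
    have "dist (\<phi> n c) (\<pi> c) < e" if n: "n \<ge> n1" for n c
    proof -
      have "(s + m) < e * n1" using n1 e by (simp add: field_simps)
      also have "\<dots> \<le> e * N n"
      proof -
        have "real n1 \<le> real n0 * n"
          using n \<open>n0 > 0\<close> by (metis mult_le_mono of_nat_le_iff of_nat_mult Suc_leI One_nat_def mult_1)
        then show ?thesis using N_ge(1)[of n] e by simp
      qed
      finally have "(s + m) / N n < e" using N[of n] by (simp add: field_simps)
      then show ?thesis using \<phi>(4)[of n c] by (simp add: dist_real_def)
    qed
    then show "\<forall>\<^sub>F n in sequentially. \<forall>c\<in>UNIV. dist (\<phi> n c) (\<pi> c) < e"
      by (auto simp: eventually_sequentially)
  qed
  moreover have "\<forall>\<^sub>F n in sequentially. \<phi> n c = \<pi> c" if c: "c \<in> rational_points" for c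
  proof -
    obtain x where x: "x \<in> \<rat>" "c = circle_of x" using c by (auto simp: rational_points_def)
    obtain i :: int and d :: nat where "x = i / d" "d \<noteq> 0"
      using x(1) by (auto simp: Rats_eq_int_div_nat)
    then have id: "d \<noteq> 0" "c = circle_of (i / d)" using x(2) by auto
    have "\<phi> n c = \<pi> c" if n: "n \<ge> d" for n
    proof -
      have "d dvd fact n" using n id by (intro dvd_fact) auto
      then have "d dvd N n" by (simp add: N_def)
      then obtain l where l: "N n = d * l" by (rule dvdE)
      have "l > 0" using l N[of n] by (cases l) auto
      then have "real_of_int i / d = of_int (i * int l) / N n" using l id by simp
      then show ?thesis using \<phi>(5)[of n "i * int l"] id by simp
    qed
    then show ?thesis by (auto simp: eventually_sequentially)
  qed
  ultimately show ?thesis using \<phi>(1-3) by (intro exI[of _ \<phi>]) blast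
qed

end
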